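(* Fix $0<M_1<M_2$ and $R_2>2M_2$, let the inner endpoint $R_1$ vary in $(2M_2,R_2)$, and set $$\Lambda(R_1):=\inf_{u\in\mathcal A_\infty(R_1,R_2)}\mathcal I[u].$$ Then $$\Lambda(R_1)=\Psi(\max\{R_1,x_0\}).$$ If $x_0>2M_2$, this gives two phases: $$\Lambda(R_1)=\begin{cases}\Psi(x_0),&2M_2<R_1\le x_0,\\ \Psi(R_1),&x_0\le R_1<R_2.\end{cases}$$ Thus the optimal rising radius $a$ is the fixed point $x_0$ in the first phase and is pinned to $R_1$ in the second. In this case the function $\Lambda$ is $C^1$ at $R_1=x_0$ but not $C^2$ there. The same point separates the square-root stability regime from the linear one: with $\delta[u]:=\mathcal J[u]-\lambda_*$, there is $C=C(M_1,M_2,R_1,R_2)$ such that for all $u\in\mathcal A_{BV}$ with $\delta[u]\le1$ one has $\|u-u_*\|_{L^1}\le C\sqrt{\delta[u]}$ if $R_1\le x_0$ and $\|u-u_*\|_{L^1}\le C\,\delta[u]$ if $R_1>x_0$. If $x_0\le2M_2$, the admissible range of $R_1$ contains only the boundary phase ($a=R_1>x_0$, $\Lambda(R_1)=\Psi(R_1)$).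
   Context: $\Delta M:=M_2-M_1$. For real $x$, $x_+=\max\{x,0\}$. $\mathcal A_\infty(R_1,R_2)$: functions $u\in C^\infty(\mathbb R)$ with $u\ge0$, $\operatorname{supp}u\subset(R_1,R_2)$, $\int_{R_1}^{R_2}r^2u\,dr=1$. $\mathcal A_{BV}$: functions $u\in BV(\mathbb R)$ with $u\ge0$ a.e., $u=0$ a.e. on $\mathbb R\setminus[R_1,R_2]$, $\int_{R_1}^{R_2}r^2u\,dr=1$. $Du=(Du)^+-(Du)^-$ is the Jordan decomposition of the distributional derivative. $P_u(r)=\int_{R_1}^r s^2u(s)\,ds$, $F_u(r)=1-\frac{2(M_1+\Delta M\,P_u(r))}{r}$ on $[R_1,R_2]$; $\mathcal I[u]=\int_{R_1}^{R_2}\frac{r^3(u')_+}{\sqrt{F_u}}\,dr$ for smooth $u$; $\mathcal J[u]=\int_{[R_1,R_2]}\frac{r^3}{\sqrt{F_u(r)}}\,d(Du)^+(r)$ for $u\in\mathcal A_{BV}$. $A(r)=\frac{R_2^3-r^3}{3}$, $q(r)=\frac{r^{7/2}}{\sqrt{r-2M_1}}$, $\Psi=q/A$ on $(2M_1,R_2)$. $x_0$ is the unique real solution of $M_1x_0^3+3R_2^3x_0-7M_1R_2^3=0$ (it depends only on $M_1,R_2$ and satisfies $2M_1<x_0<R_2$, $x_0<7M_1/3$). $a=\max\{R_1,x_0\}$ (the optimal rising radius), $\lambda_*=\Psi(a)$, $H_*=1/A(a)$, $u_*=H_*\mathbf 1_{(a,R_2)}$. *)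

theory Defs
  imports "HOL-Analysis.Analysis"
begin

definition smooth :: "(real \<Rightarrow> real) \<Rightarrow> bool" where
  "smooth f \<longleftrightarrow> (\<forall>k x. (deriv ^^ k) f field_differentiable at x)"

definition supp :: "(real \<Rightarrow> real) \<Rightarrow> real set" where
  "supp f = closure {x. f x \<noteq> 0}"

text \<open>\<open>f\<close> is of class \<open>C\<^sup>k\<close> on some open neighbourhood of \<open>x\<close>. This does not depend on
  the values of \<open>f\<close> away from \<open>x\<close>.\<close>

definition Ck_at :: "nat \<Rightarrow> (real \<Rightarrow> real) \<Rightarrow> real \<Rightarrow> bool" where
  "Ck_at k f x \<longleftrightarrow>
     (\<exists>U. open U \<and> x \<in> U \<and>
          (\<forall>j<k. \<forall>y\<in>U. (deriv ^^ j) f field_differentiable at y) \<and>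
          continuous_on U ((deriv ^^ k) f))"

text \<open>The distributional derivative of \<open>u\<close> is the finite signed Borel measure \<open>\<mu> - \<nu>\<close>.
  A finite signed measure is represented as a difference of two finite measures; the
  representation is not unique unless \<open>\<mu>\<close> and \<open>\<nu>\<close> are mutually singular.\<close>

definition has_distr_deriv :: "(real \<Rightarrow> real) \<Rightarrow> real measure \<Rightarrow> real measure \<Rightarrow> bool" where
  "has_distr_deriv u \<mu> \<nu> \<longleftrightarrow>
     finite_measure \<mu> \<and> sets \<mu> = sets borel \<and>
     finite_measure \<nu> \<and> sets \<nu> = sets borel \<and>
     (\<forall>\<phi>. smooth \<phi> \<and> compact (supp \<phi>) \<longrightarrow>
        (LINT x|lebesgue. u x * deriv \<phi> x) = - ((LINT x|\<mu>. \<phi> x) - (LINT x|\<nu>. \<phi> x)))"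

definition BV :: "(real \<Rightarrow> real) set" where
  "BV = {u. integrable lebesgue u \<and> (\<exists>\<mu> \<nu>. has_distr_deriv u \<mu> \<nu>)}"

definition mutually_singular :: "real measure \<Rightarrow> real measure \<Rightarrow> bool" where
  "mutually_singular \<mu> \<nu> \<longleftrightarrow>
     (\<exists>S \<in> sets borel. emeasure \<mu> (- S) = 0 \<and> emeasure \<nu> S = 0)"

text \<open>The positive part \<open>(Du)\<^sup>+\<close> of the Jordan decomposition of \<open>Du\<close>. For \<open>u \<in> BV\<close> the
  mutually singular pair exists and is unique, so the choice operator has nothing to choose.\<close>

definition D_pos :: "(real \<Rightarrow> real) \<Rightarrow> real measure" where
  "D_pos u = (SOME \<mu>. \<exists>\<nu>. has_distr_deriv u \<mu> \<nu> \<and> mutually_singular \<mu> \<nu>)"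

definition A_smooth :: "real \<Rightarrow> real \<Rightarrow> (real \<Rightarrow> real) set" where
  "A_smooth R1 R2 =
     {u. smooth u \<and> (\<forall>r. 0 \<le> u r) \<and> supp u \<subseteq> {R1<..<R2} \<and>
         (LINT r:{R1..R2}|lebesgue. r^2 * u r) = 1}"

text \<open>Elements of \<open>BV\<close> are representatives of almost-everywhere classes, so all conditions
  below (and all functionals evaluated on this class) only depend on the class.\<close>

definition A_BV :: "real \<Rightarrow> real \<Rightarrow> (real \<Rightarrow> real) set" where
  "A_BV R1 R2 =
     {u \<in> BV. (AE r in lebesgue. 0 \<le> u r) \<and>
              (AE r in lebesgue. r \<notin> {R1..R2} \<longrightarrow> u r = 0) \<and>
              (LINT r:{R1..R2}|lebesgue. r^2 * u r) = 1}"

definition P_fun :: "real \<Rightarrow> (real \<Rightarrow> real) \<Rightarrow> real \<Rightarrow> real" where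
  "P_fun R1 u r = (LINT s:{R1..r}|lebesgue. s^2 * u s)"

definition F_fun :: "real \<Rightarrow> real \<Rightarrow> real \<Rightarrow> (real \<Rightarrow> real) \<Rightarrow> real \<Rightarrow> real" where
  "F_fun M1 M2 R1 u r = 1 - 2 * (M1 + (M2 - M1) * P_fun R1 u r) / r"

definition I_fun :: "real \<Rightarrow> real \<Rightarrow> real \<Rightarrow> real \<Rightarrow> (real \<Rightarrow> real) \<Rightarrow> real" where
  "I_fun M1 M2 R1 R2 u =
     (LINT r:{R1..R2}|lebesgue. r^3 * max (deriv u r) 0 / sqrt (F_fun M1 M2 R1 u r))"

definition J_fun :: "real \<Rightarrow> real \<Rightarrow> real \<Rightarrow> real \<Rightarrow> (real \<Rightarrow> real) \<Rightarrow> real" where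
  "J_fun M1 M2 R1 R2 u =
     (LINT r:{R1..R2}|D_pos u. r^3 / sqrt (F_fun M1 M2 R1 u r))"

definition Lambda :: "real \<Rightarrow> real \<Rightarrow> real \<Rightarrow> real \<Rightarrow> real" where
  "Lambda M1 M2 R2 R1 = (INF u \<in> A_smooth R1 R2. I_fun M1 M2 R1 R2 u)"

definition A_fun :: "real \<Rightarrow> real \<Rightarrow> real" where
  "A_fun R2 r = (R2^3 - r^3) / 3"

definition q_fun :: "real \<Rightarrow> real \<Rightarrow> real" where
  "q_fun M1 r = r powr (7/2) / sqrt (r - 2 * M1)"

definition Psi :: "real \<Rightarrow> real \<Rightarrow> real \<Rightarrow> real" where
  "Psi M1 R2 r = q_fun M1 r / A_fun R2 r"

definition x_crit :: "real \<Rightarrow> real \<Rightarrow> real" where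
  "x_crit M1 R2 = (THE x. M1 * x^3 + 3 * R2^3 * x - 7 * M1 * R2^3 = 0)"

definition a_opt :: "real \<Rightarrow> real \<Rightarrow> real \<Rightarrow> real" where
  "a_opt M1 R1 R2 = max R1 (x_crit M1 R2)"

definition lambda_opt :: "real \<Rightarrow> real \<Rightarrow> real \<Rightarrow> real" where
  "lambda_opt M1 R1 R2 = Psi M1 R2 (a_opt M1 R1 R2)"

definition H_opt :: "real \<Rightarrow> real \<Rightarrow> real \<Rightarrow> real" where
  "H_opt M1 R1 R2 = 1 / A_fun R2 (a_opt M1 R1 R2)"

definition u_opt :: "real \<Rightarrow> real \<Rightarrow> real \<Rightarrow> real \<Rightarrow> real" where
  "u_opt M1 R1 R2 r = H_opt M1 R1 R2 * indicator {a_opt M1 R1 R2<..<R2} r"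

definition deficit :: "real \<Rightarrow> real \<Rightarrow> real \<Rightarrow> real \<Rightarrow> (real \<Rightarrow> real) \<Rightarrow> real" where
  "deficit M1 M2 R1 R2 u = J_fun M1 M2 R1 R2 u - lambda_opt M1 R1 R2"

definition L1_norm :: "(real \<Rightarrow> real) \<Rightarrow> real" where
  "L1_norm f = (LINT r|lebesgue. \<bar>f r\<bar>)"

end

theory Submission
  imports Defs
begin

text \<open>Since \<open>F\<^sub>u(r) \<le> 1 - 2 M\<^sub>1 / r\<close>, the weight \<open>r\<^sup>3 / \<surd>F\<^sub>u\<close> dominates \<open>q\<close>, while Fubini turns the mass
  constraint into \<open>\<integral> A d(Du)\<^sup>+ - \<integral> A d(Du)\<^sup>- = 1\<close>. Hence the deficit is at least
  \<open>\<integral> (q - \<lambda>\<^sub>* A) d(Du)\<^sup>+ + \<lambda>\<^sub>* \<integral> A d(Du)\<^sup>-\<close>. The sign of \<open>\<Psi>'\<close> is that of the cubic defining \<open>x\<^sub>0\<close>, so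
  \<open>q - \<lambda>\<^sub>* A\<close> is bounded below by a multiple of \<open>(r - a)\<^sup>2\<close> if \<open>R\<^sub>1 \<le> x\<^sub>0\<close> and of \<open>r - a\<close> otherwise; this gives
  the lower bound \<open>\<lambda>\<^sub>*\<close>. It is attained in the limit by smooth steps rising just after \<open>a\<close>
  and falling just before \<open>R\<^sub>2\<close>, where almost no mass has accumulated while \<open>u\<close> rises. For the
  stability, \<open>\<parallel>u - m 1\<^bsub>(a,R\<^sub>2)\<^esub>\<parallel>\<close> with \<open>m = (Du)\<^sup>+[R\<^sub>1,R\<^sub>2]\<close> is at most
  \<open>\<integral> \<bar>x - a\<bar> d(Du)\<^sup>+ + \<integral> (R\<^sub>2 - x) d(Du)\<^sup>-\<close>, and the mass constraint controls \<open>m - H\<^sub>*\<close>.\<close>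

section \<open>Smooth functions\<close>

text \<open>The number \<open>l\<close> is the multiplier of the mass constraint: the gap
  \<open>q - l A\<close> is nonnegative on \<open>[R1, R2]\<close> and vanishes at \<open>a\<close>.
  If \<open>a\<close> is the critical point \<open>x0\<close>, the gap touches zero tangentially; if
  \<open>a\<close> is pinned to \<open>R1 > x0\<close>, it leaves zero with positive slope. A
  quadratic gap controls only a second moment of (Du)^+ about \<open>a\<close>, and Cauchy-Schwarz,
  which needs a bound on the total rise, then costs the square root. Falls are paid for at a linear
  rate in both regimes, because \<open>A\<close> vanishes only to first order at \<open>R2\<close>.

  The obstacle on the BV side is that \<open>Du\<close> is known only through smooth compactly
  supported test functions, whereas the argument needs integrals over the closed interval
  \<open>[R1, R2]\<close>, whose endpoints may carry atoms. For this reason \<open>u\<close> is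
  identified almost everywhere with a difference of two distribution functions. The parts of the two
  measures to the left of \<open>R1\<close> cancel there, and from then on testing against
  \<open>A\<close>, against \<open>R2 - x\<close> or against \<open>\<bar>x - a\<bar>\<close> is an
  instance of Fubini for a bounded kernel.\<close>

lemma smooth_coinduct:
  assumes "P f"
    and step: "\<And>g. P g \<Longrightarrow> P (deriv g) \<and> (\<forall>x. g field_differentiable at x)"
  shows "smooth f"
proof -
  have "P ((deriv ^^ k) f)" for k
    by (induction k) (use assms in auto)
  then show ?thesis unfolding smooth_def using step by blast
qed

lemma smooth_differentiable: "smooth f \<Longrightarrow> f field_differentiable at x"
  unfolding smooth_def by (metis funpow_0)

lemma smooth_DERIV: "smooth f \<Longrightarrow> (f has_real_derivative deriv f x) (at x)"
  using smooth_differentiable DERIV_deriv_iff_field_differentiable by blast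

lemma smooth_deriv: "smooth f \<Longrightarrow> smooth (deriv f)"
  unfolding smooth_def by (metis comp_apply funpow_Suc_right)

lemma smooth_continuous_on: "smooth f \<Longrightarrow> continuous_on S f"
  by (meson DERIV_continuous continuous_at_imp_continuous_on smooth_DERIV)

lemma smooth_if_DERIV:
  assumes "smooth g" "\<And>x. (f has_real_derivative g x) (at x)"
  shows "smooth f"
proof -
  have "deriv f = g" using assms(2) DERIV_imp_deriv by blast
  have "(deriv ^^ k) f field_differentiable at x" for k x
  proof (cases k)
    case 0 then show ?thesis using assms(2) field_differentiable_def by auto
  next
    case (Suc j)
    then have "(deriv ^^ k) f = (deriv ^^ j) g"
      using \<open>deriv f = g\<close> by (simp add: funpow_Suc_right del: funpow.simps)
    then show ?thesis using assms(1) by (simp add: smooth_def)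
  qed
  then show ?thesis by (simp add: smooth_def)
qed

lemma smooth_const: "smooth (\<lambda>x. c)"
  by (rule smooth_coinduct[where P = "\<lambda>f. \<exists>c. f = (\<lambda>x. c)"]) auto

lemma smooth_add:
  assumes "smooth f" "smooth g"
  shows "smooth (\<lambda>x. f x + g x)"
proof (rule smooth_coinduct[where P = "\<lambda>h. \<exists>f g. smooth f \<and> smooth g \<and> h = (\<lambda>x. f x + g x)"])
  fix h assume "\<exists>f g. smooth f \<and> smooth g \<and> h = (\<lambda>x. f x + g x)"
  then obtain f g where fg: "smooth f" "smooth g" and h: "h = (\<lambda>x. f x + g x)" by blast
  have D: "(h has_real_derivative deriv f x + deriv g x) (at x)" for x
    unfolding h by (intro DERIV_add smooth_DERIV fg)
  then have "deriv h = (\<lambda>x. deriv f x + deriv g x)" using DERIV_imp_deriv by blast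
  with D fg show "(\<exists>f g. smooth f \<and> smooth g \<and> deriv h = (\<lambda>x. f x + g x))
      \<and> (\<forall>x. h field_differentiable at x)"
    using smooth_deriv field_differentiable_def by blast
qed (use assms in auto)

text \<open>The scale \<open>k\<close> belongs to the coinductive family because differentiation
  multiplies it by the inner slope \<open>c\<close>, while \<open>c\<close> and \<open>d\<close>
  stay fixed.\<close>

lemma smooth_affine:
  assumes "smooth f"
  shows "smooth (\<lambda>x. k * f (c * x + d))"
proof (rule smooth_coinduct[where P = "\<lambda>h. \<exists>f k. smooth f \<and> h = (\<lambda>x. k * f (c * x + d))"])
  fix h assume "\<exists>f k. smooth f \<and> h = (\<lambda>x. k * f (c * x + d))"
  then obtain f k where f: "smooth f" and h: "h = (\<lambda>x. k * f (c * x + d))" by blast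
  have D: "(h has_real_derivative (k * c) * deriv f (c * x + d)) (at x)" for x
    unfolding h by (auto intro!: derivative_eq_intros DERIV_chain'[OF _ smooth_DERIV[OF f]])
  then have "deriv h = (\<lambda>x. (k * c) * deriv f (c * x + d))" using DERIV_imp_deriv by blast
  with D f show "(\<exists>f k. smooth f \<and> deriv h = (\<lambda>x. k * f (c * x + d)))
      \<and> (\<forall>x. h field_differentiable at x)"
    using smooth_deriv field_differentiable_def by blast
qed (use assms in auto)

text \<open>Unlike the products themselves, finite sums of products are closed under \<^const>\<open>deriv\<close>.\<close>

inductive product_sum :: "(real \<Rightarrow> real) \<Rightarrow> bool" where
  product: "smooth f \<Longrightarrow> smooth g \<Longrightarrow> product_sum (\<lambda>x. f x * g x)"
| add: "product_sum f \<Longrightarrow> product_sum g \<Longrightarrow> product_sum (\<lambda>x. f x + g x)"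

lemma smooth_mult:
  assumes "smooth f" "smooth g"
  shows "smooth (\<lambda>x. f x * g x)"
proof (rule smooth_coinduct[of product_sum])
  show "product_sum (\<lambda>x. f x * g x)" using assms by (rule product_sum.product)
next
  fix h assume "product_sum h"
  then show "product_sum (deriv h) \<and> (\<forall>x. h field_differentiable at x)"
  proof induction
    case (product f g)
    have D: "((\<lambda>x. f x * g x) has_real_derivative f x * deriv g x + deriv f x * g x) (at x)" for x
      by (intro DERIV_mult' smooth_DERIV product)
    have "product_sum (\<lambda>x. f x * deriv g x + deriv f x * g x)"
      by (intro product_sum.intros smooth_deriv product)
    moreover have "deriv (\<lambda>x. f x * g x) = (\<lambda>x. f x * deriv g x + deriv f x * g x)"
      using D DERIV_imp_deriv by blast
    ultimately show ?case using D field_differentiable_def by auto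
  next
    case (add f g)
    then have "deriv (\<lambda>x. f x + g x) = (\<lambda>x. deriv f x + deriv g x)"
      by (auto intro!: deriv_add)
    with add show ?case
      by (auto intro: product_sum.add field_differentiable_add)
  qed
qed

text \<open>All derivatives of \<open>exp (-1/x)\<close>, extended by \<open>0\<close> to \<open>x \<le> 0\<close>, lie in the following family.\<close>

definition flat_exp :: "real poly \<Rightarrow> real \<Rightarrow> real" where
  "flat_exp p x = (if 0 < x then poly p (1 / x) * exp (- (1 / x)) else 0)"

lemma poly_div_exp_tendsto_0: "((\<lambda>x::real. poly p x / exp x) \<longlongrightarrow> 0) at_top"
proof -
  have "((\<lambda>x::real. \<Sum>i\<le>degree p. coeff p i * (x ^ i / exp x)) \<longlongrightarrow> (\<Sum>i\<le>degree p. coeff p i * 0)) at_top"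
    by (intro tendsto_intros tendsto_power_div_exp_0)
  then show ?thesis by (simp add: poly_altdef sum_divide_distrib)
qed

text \<open>With y = 1/x, the derivative of p(y) exp(-y) in x is y^2 (p(y) - p'(y)) exp(-y), which
  explains the new polynomial. At the origin the exponential beats every polynomial in y.\<close>

lemma flat_exp_DERIV:
  "(flat_exp p has_real_derivative flat_exp (monom 1 2 * (p - pderiv p)) x) (at x)"
proof -
  consider "x < 0" | "x > 0" | "x = 0" by linarith
  then show ?thesis
  proof cases
    case 1
    have "((\<lambda>x. 0) has_real_derivative 0) (at x)" by simp
    then have "(flat_exp p has_real_derivative 0) (at x)"
      by (rule has_field_derivative_transform_within_open[of _ _ _ "{..<0}"])
        (use 1 in \<open>auto simp: flat_exp_def\<close>)
    with 1 show ?thesis by (simp add: flat_exp_def)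
  next
    case 2
    have "((\<lambda>x. poly p (1 / x) * exp (- (1 / x))) has_real_derivative
        flat_exp (monom 1 2 * (p - pderiv p)) x) (at x)"
      using 2 by (auto intro!: derivative_eq_intros DERIV_chain'[OF _ poly_DERIV]
          simp: flat_exp_def poly_monom power2_eq_square field_simps)
    then show ?thesis
      by (rule has_field_derivative_transform_within_open[of _ _ _ "{0<..}"])
        (use 2 in \<open>auto simp: flat_exp_def\<close>)
  next
    case 3
    have *: "((\<lambda>h. flat_exp p h / h) \<longlongrightarrow> 0) (at_right 0)"
    proof -
      \<comment> \<open>\<open>pCons 0 p\<close> is y p(y): the extra factor y = 1/h comes from the
        difference quotient.\<close>
      have "((\<lambda>h. poly (pCons 0 p) (inverse h) / exp (inverse h)) \<longlongrightarrow> 0) (at_right (0::real))"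
        by (rule filterlim_compose[OF poly_div_exp_tendsto_0 filterlim_inverse_at_top_right])
      moreover have "eventually (\<lambda>h. poly (pCons 0 p) (inverse h) / exp (inverse h) = flat_exp p h / h) (at_right 0)"
        by (auto simp: eventually_at_filter flat_exp_def exp_minus field_simps)
      ultimately show ?thesis by (rule Lim_transform_eventually)
    qed
    have "((\<lambda>h. flat_exp p h / h) \<longlongrightarrow> 0) (at_left 0)"
      by (rule tendsto_eventually) (auto simp: eventually_at_filter flat_exp_def)
    with * have "((\<lambda>h. flat_exp p h / h) \<longlongrightarrow> 0) (at 0)"
      by (rule filterlim_split_at_real[rotated])
    with 3 show ?thesis by (simp add: DERIV_def flat_exp_def)
  qed
qed

lemma smooth_flat_exp: "smooth (flat_exp p)"
proof (rule smooth_coinduct[where P = "\<lambda>f. \<exists>p. f = flat_exp p"])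
  fix g assume "\<exists>p. g = flat_exp p"
  then obtain p where g: "g = flat_exp p" ..
  have "deriv g = flat_exp (monom 1 2 * (p - pderiv p))"
    unfolding g using flat_exp_DERIV DERIV_imp_deriv by blast
  then show "(\<exists>p. deriv g = flat_exp p) \<and> (\<forall>x. g field_differentiable at x)"
    using flat_exp_DERIV field_differentiable_def g by blast
qed auto

text \<open>Integrating from -1 instead of 0 makes 0 an interior point, so the fundamental theorem
  gives a two-sided derivative there. Further left both functions are zero.\<close>

lemma antiderivative_vanishing_left:
  fixes b :: "real \<Rightarrow> real"
  assumes cont: "continuous_on UNIV b" and b_left: "\<And>x. x \<le> 0 \<Longrightarrow> b x = 0"
  obtains B where "\<And>x. (B has_real_derivative b x) (at x)" "\<And>x. x \<le> 0 \<Longrightarrow> B x = 0"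
proof -
  define B where "B x = integral {-1..x} b" for x
  have DB: "(B has_real_derivative b x) (at x)" if "x > -1" for x
  proof -
    have "(B has_vector_derivative b x) (at x within {-1..x + 1})"
      unfolding B_def by (rule integral_has_vector_derivative)
        (use that continuous_on_subset[OF cont] in auto)
    then have "(B has_vector_derivative b x) (at x)"
      using that by (simp add: at_within_Icc_at)
    then show ?thesis by (simp add: has_real_derivative_iff_has_vector_derivative)
  qed
  have B0: "B x = 0" if "x \<le> 0" for x
  proof -
    have "B x = integral {-1..x} (\<lambda>_. 0)"
      unfolding B_def using that by (intro integral_cong) (auto simp: b_left)
    then show ?thesis by simp
  qed
  have B: "(B has_real_derivative b x) (at x)" for x
  proof (cases "x > -1")
    case False
    have "((\<lambda>x. 0) has_real_derivative 0) (at x)" by simp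
    then have "(B has_real_derivative 0) (at x)"
      by (rule has_field_derivative_transform_within_open[of _ _ _ "{..<0}"])
        (use False in \<open>auto simp: B0\<close>)
    with False show ?thesis by (simp add: b_left)
  qed (rule DB)
  show ?thesis using that B B0 by blast
qed

lemma smooth_step_exists:
  obtains \<theta> :: "real \<Rightarrow> real" where "smooth \<theta>" "mono \<theta>"
    "\<And>x. x \<le> 0 \<Longrightarrow> \<theta> x = 0" "\<And>x. 1 \<le> x \<Longrightarrow> \<theta> x = 1" "\<And>x. deriv \<theta> x \<ge> 0"
    "\<And>x. x \<notin> {0<..<1} \<Longrightarrow> deriv \<theta> x = 0"
    "\<And>x. 0 \<le> \<theta> x" "\<And>x. \<theta> x \<le> 1"
proof -
  \<comment> \<open>A bump that is positive exactly on (0,1); the step is its antiderivative divided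
    by the total integral.\<close>
  define b where "b x = flat_exp 1 x * flat_exp 1 (1 - x)" for x
  have b: "smooth b" unfolding b_def
    using smooth_mult[OF smooth_flat_exp smooth_affine[OF smooth_flat_exp, of 1 _ "-1" 1]] by simp
  have b0: "b x \<ge> 0" for x by (auto simp: b_def flat_exp_def)
  have b_out: "b x = 0" if "x \<notin> {0<..<1}" for x using that by (auto simp: b_def flat_exp_def)
  obtain B where B: "\<And>x. (B has_real_derivative b x) (at x)" and B0: "\<And>x. x \<le> 0 \<Longrightarrow> B x = 0"
    by (rule antiderivative_vanishing_left[OF smooth_continuous_on[OF b]]) (use b_out in auto)
  have mono: "B x \<le> B y" if "x \<le> y" for x y
    using DERIV_nonneg_imp_nondecreasing[OF that] B b0 by blast
  have B1: "B x = B 1" if "1 \<le> x" for x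
  proof -
    have "\<exists>c. \<forall>x\<in>{1..}. B x = c"
      by (rule has_field_derivative_zero_constant)
        (auto intro!: has_field_derivative_at_within B[THEN DERIV_cong] simp: b_out)
    then show ?thesis using that by auto
  qed
  have "B 0 < B (1/2)"
  proof (rule DERIV_pos_imp_increasing_open[where f = B])
    show "continuous_on {0..1/2} B"
      using B DERIV_continuous continuous_at_imp_continuous_on by blast
    show "\<exists>y. (B has_real_derivative y) (at x) \<and> y > 0" if "0 < x" "x < 1/2" for x
    proof (intro exI[of _ "b x"] conjI B)
      show "b x > 0" using that by (simp add: b_def flat_exp_def)
    qed
  qed simp
  then have B1_pos: "B 1 > 0" using mono[of "1/2" 1] B0[of 0] by simp
  define \<theta> where "\<theta> x = B x / B 1" for x
  have D: "(\<theta> has_real_derivative b x / B 1) (at x)" for x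
    unfolding \<theta>_def by (intro DERIV_cdivide B)
  then have deriv: "deriv \<theta> x = b x / B 1" for x using DERIV_imp_deriv by blast
  show ?thesis
  proof
    show "smooth \<theta>"
      using smooth_if_DERIV[OF _ D] smooth_affine[OF b, of "1 / B 1" 1 0] by simp
    show "mono \<theta>" unfolding \<theta>_def mono_def using mono B1_pos by (simp add: divide_right_mono)
    show "\<theta> x = 0" if "x \<le> 0" for x using B0[OF that] by (simp add: \<theta>_def)
    show "\<theta> x = 1" if "1 \<le> x" for x using B1[OF that] B1_pos by (simp add: \<theta>_def)
    show "deriv \<theta> x \<ge> 0" for x using b0 B1_pos by (simp add: deriv)
    show "deriv \<theta> x = 0" if "x \<notin> {0<..<1}" for x using b_out[OF that] by (simp add: deriv)
    show "0 \<le> \<theta> x" for x using mono[of "min x 0" x] B0[of "min x 0"] B1_pos by (simp add: \<theta>_def)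
    show "\<theta> x \<le> 1" for x using mono[of x "max x 1"] B1[of "max x 1"] B1_pos by (simp add: \<theta>_def)
  qed
qed

section \<open>The function \<open>\<Psi>\<close>\<close>

definition crit_poly :: "real \<Rightarrow> real \<Rightarrow> real \<Rightarrow> real" where
  "crit_poly M R r = M * r^3 + 3 * R^3 * r - 7 * M * R^3"

lemma crit_poly_diff:
  "crit_poly M R r - crit_poly M R s = (r - s) * (M * (r\<^sup>2 + r * s + s\<^sup>2) + 3 * R^3)"
  by (simp add: crit_poly_def algebra_simps power2_eq_square power3_eq_cube)

text \<open>Because \<open>r\<^sup>2 + r * s + s\<^sup>2\<close> is nonnegative, the cubic has slope
  at least \<open>3 * R^3\<close>. Its zero is therefore simple, which later gives quadratic growth
  of \<open>Psi\<close> and a jump in the second derivative of \<open>Lambda\<close>.\<close>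

lemma crit_poly_mono:
  assumes "0 < M" "0 < R" "s \<le> r"
  shows "crit_poly M R s + 3 * R^3 * (r - s) \<le> crit_poly M R r"
proof -
  have "r\<^sup>2 + r * s + s\<^sup>2 = ((r + s)\<^sup>2 + r\<^sup>2 + s\<^sup>2) / 2"
    by (simp add: power2_eq_square algebra_simps)
  then have "0 \<le> r\<^sup>2 + r * s + s\<^sup>2" by (metis add_nonneg_nonneg divide_nonneg_nonneg zero_le_numeral zero_le_power2)
  then have "0 \<le> (r - s) * (M * (r\<^sup>2 + r * s + s\<^sup>2))" using assms by simp
  then show ?thesis using crit_poly_diff[of M R r s] by (simp add: algebra_simps)
qed

text \<open>The cubic equals \<open>M * ((2 * M)^3 - R^3) < 0\<close> at \<open>2 * M\<close> and
  \<open>3 * R^3 * (R - 2 * M) > 0\<close> at \<open>R\<close>. Strict monotonicity supplies the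
  uniqueness that the definite description requires.\<close>

lemma x_crit:
  assumes "0 < M" "2 * M < R"
  shows "crit_poly M R (x_crit M R) = 0" "2 * M < x_crit M R" "x_crit M R < R"
proof -
  have R: "0 < R" using assms by simp
  have lt: "crit_poly M R (2 * M) < 0"
  proof -
    have "(2 * M)^3 < R^3" using assms by (intro power_strict_mono) auto
    then have "M * ((2 * M)^3 - R^3) < 0" using assms by (simp add: mult_less_0_iff)
    then show ?thesis by (simp add: crit_poly_def algebra_simps)
  qed
  have gt: "crit_poly M R R > 0"
  proof -
    have "crit_poly M R R = 3 * R^3 * (R - 2 * M)" by (simp add: crit_poly_def algebra_simps)
    then show ?thesis using assms R by simp
  qed
  have "\<exists>x\<ge>2 * M. x \<le> R \<and> crit_poly M R x = 0"
    by (rule IVT') (use lt gt assms in \<open>auto simp: crit_poly_def intro!: continuous_intros\<close>)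
  then obtain x where x: "2 * M \<le> x" "x \<le> R" "crit_poly M R x = 0" by blast
  have uniq: "y = x" if "crit_poly M R y = 0" for y
  proof (rule ccontr)
    assume "y \<noteq> x"
    then consider "y < x" | "x < y" by linarith
    then show False
    proof cases
      case 1 then have "3 * R^3 * (x - y) > 0" using R by simp
      then show False using crit_poly_mono[of M R y x] assms R 1 x that by linarith
    next
      case 2 then have "3 * R^3 * (y - x) > 0" using R by simp
      then show False using crit_poly_mono[of M R x y] assms R 2 x that by linarith
    qed
  qed
  have eq: "x_crit M R = x" unfolding x_crit_def
    unfolding crit_poly_def[symmetric] using x(3) uniq by (rule the_equality)
  show "crit_poly M R (x_crit M R) = 0" using x eq by simp
  show "2 * M < x_crit M R" using x lt eq by (metis less_eq_real_def less_irrefl)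
  show "x_crit M R < R" using x gt eq by (metis less_eq_real_def less_irrefl)
qed

text \<open>So \<open>q\<close> is the weight \<open>r^3 / sqrt F\<close> with no shell mass
  accumulated yet, the smallest value that the weight can take at \<open>r\<close>.\<close>

lemma q_fun_alt:
  assumes "0 < M" "2 * M < r"
  shows "q_fun M r = r^3 / sqrt (1 - 2 * M / r)"
proof -
  have r: "0 < r" using assms by simp
  have "r powr (7/2) = r^3 * sqrt r"
    using r powr_add[of r 3 "1/2"] by (simp add: powr_half_sqrt)
  moreover have "sqrt (1 - 2 * M / r) = sqrt (r - 2 * M) / sqrt r"
    using r by (simp add: diff_divide_distrib flip: real_sqrt_divide)
  ultimately show ?thesis using r assms by (simp add: q_fun_def)
qed

lemma q_fun_ge:
  assumes "0 < M" "2 * M < r"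
  shows "r^3 \<le> q_fun M r"
proof -
  have r: "0 < r" using assms by simp
  have "sqrt (1 - 2 * M / r) \<le> 1" "0 < sqrt (1 - 2 * M / r)" using assms r by auto
  then show ?thesis using r by (simp add: q_fun_alt[OF assms] le_divide_eq mult_left_le)
qed

lemma A_fun_pos: "0 < r \<Longrightarrow> r < R \<Longrightarrow> 0 < A_fun R r"
  by (simp add: A_fun_def power_strict_mono)

lemma A_fun_nonneg: "0 < r \<Longrightarrow> r \<le> R \<Longrightarrow> 0 \<le> A_fun R r"
  by (simp add: A_fun_def power_mono)

lemma A_fun_continuous_on: "continuous_on S (A_fun R)"
  unfolding A_fun_def by (intro continuous_intros) auto

lemma A_fun_DERIV: "(A_fun R has_real_derivative - (r\<^sup>2)) (at r)"
  unfolding A_fun_def by (auto intro!: derivative_eq_intros)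

lemma Psi_pos: "0 < M \<Longrightarrow> 2 * M < r \<Longrightarrow> r < R \<Longrightarrow> 0 < Psi M R r"
  using A_fun_pos[of r R] by (simp add: Psi_def q_fun_def)

text \<open>The logarithmic derivative of \<open>Psi\<close> is 7/(2r) - 1/(2(r - 2M)) + 3r^2/(R^3 -
  r^3). Over the common denominator r (r - 2M) (R^3 - r^3) its numerator is the cubic, so this is
  the positive cofactor of the cubic in the derivative of \<open>Psi\<close>.\<close>

definition Psi_weight :: "real \<Rightarrow> real \<Rightarrow> real \<Rightarrow> real" where
  "Psi_weight M R r = Psi M R r / (r * (r - 2 * M) * (R^3 - r^3))"

lemma Psi_DERIV:
  assumes "0 < M" "2 * M < r" "r < R"
  shows "(Psi M R has_real_derivative Psi_weight M R r * crit_poly M R r) (at r)"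
proof -
  have r: "0 < r" "r - 2 * M > 0" using assms by auto
  have A: "A_fun R r > 0" using A_fun_pos r assms by blast
  then have Rr: "R^3 - r^3 > 0" by (simp add: A_fun_def)
  have s: "sqrt (r - 2 * M) * sqrt (r - 2 * M) = r - 2 * M" using r by simp
  have D7: "((\<lambda>r. r powr (7/2)) has_real_derivative (7/2) * r powr (7/2) / r) (at r)"
  proof -
    have "r powr (7/2 - 1) = r powr (7/2) / r" using r powr_diff[of r "7/2" 1] by simp
    then show ?thesis using r has_real_derivative_powr[of r "7/2"] by simp
  qed
  have Ds: "((\<lambda>r. sqrt (r - 2 * M)) has_real_derivative sqrt (r - 2 * M) / (2 * (r - 2 * M))) (at r)"
    using r s by (auto intro!: derivative_eq_intros simp: field_simps)
  define T where "T = r powr (7/2)"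
  define S where "S = sqrt (r - 2 * M)"
  have S: "S > 0" using r by (simp add: S_def)
  have "(Psi M R has_real_derivative
     (((7/2) * T / r * S - T * (S / (2 * (r - 2 * M)))) / (S * S) * A_fun R r
       - T / S * (- (r^2))) / (A_fun R r * A_fun R r)) (at r)"
    unfolding Psi_def q_fun_def T_def S_def
    by (intro DERIV_divide D7 Ds A_fun_DERIV) (use A S S_def in auto)
  moreover have "(((7/2) * T / r * S - T * (S / (2 * (r - 2 * M)))) / (S * S) * A_fun R r
       - T / S * (- (r^2))) / (A_fun R r * A_fun R r) = Psi_weight M R r * crit_poly M R r"
  proof -
    define d where "d = r - 2 * M"
    have M: "M = (r - d) / 2" by (simp add: d_def)
    have d: "d > 0" using r d_def by simp
    have "((7/2) * T / r * S - T * (S / (2 * d))) / (S * S) = T / S * ((7 * d - r) / (2 * r * d))"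
      using r S d by (simp add: field_simps)
    then have "(((7/2) * T / r * S - T * (S / (2 * d))) / (S * S) * A_fun R r
       - T / S * (- (r^2))) / (A_fun R r * A_fun R r)
       = T / S * ((7 * d - r) / (2 * r * d) * A_fun R r + r^2) / (A_fun R r * A_fun R r)"
      by (simp add: algebra_simps)
    also have "\<dots> = T / S / A_fun R r * (((7 * d - r) / (2 * r * d) * A_fun R r + r^2) / A_fun R r)"
      by simp
    also have "((7 * d - r) / (2 * r * d) * A_fun R r + r^2) / A_fun R r
        = crit_poly M R r / (r * d * (R^3 - r^3))"
      using r d Rr unfolding A_fun_def crit_poly_def M
      by (simp add: divide_simps) (simp add: algebra_simps power2_eq_square power3_eq_cube)
    finally show ?thesis
      by (simp add: Psi_weight_def Psi_def q_fun_def T_def S_def d_def)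
  qed
  ultimately show ?thesis by simp
qed

lemma Psi_weight_ge:
  assumes "0 < M" "2 * M < R1" "R1 < R"
  obtains c where "0 < c" "\<And>r. R1 \<le> r \<Longrightarrow> r < R \<Longrightarrow> c \<le> Psi_weight M R r"
proof
  \<comment> \<open>The factor \<open>3 * R1^3 / R^3\<close> bounds \<open>Psi\<close> from below,
    by q \<ge> r^3 \<ge> R1^3 and A \<le> R^3/3; the divisor \<open>R * R * R^3\<close> bounds the
    denominator of the weight from above.\<close>
  show "0 < 3 * R1^3 / R^3 / (R * R * R^3)" using assms by simp
  fix r assume r: "R1 \<le> r" "r < R"
  have R: "0 < R" "0 < R1" "0 < r" using assms r by auto
  have A: "A_fun R r > 0" using A_fun_pos R r by blast
  have "R1^3 \<le> r^3" using R r by (intro power_mono) auto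
  also have "\<dots> \<le> q_fun M r" using q_fun_ge assms r by simp
  finally have "R1^3 / (R^3 / 3) \<le> Psi M R r"
    unfolding Psi_def using A R by (intro frac_le) (auto simp: A_fun_def intro: order_trans[rotated])
  then show "3 * R1^3 / R^3 / (R * R * R^3) \<le> Psi_weight M R r"
    unfolding Psi_weight_def using A R assms r Psi_pos[of M r R]
    by (intro frac_le mult_mono mult_pos_pos) (auto simp: A_fun_def field_simps)
qed

text \<open>The cubic has a simple zero at \<open>x0\<close> and its cofactor is at least
  \<open>k\<close>, so \<open>Psi\<close> minus a suitable parabola falls up to \<open>x0\<close>
  and rises after it.\<close>

lemma Psi_growth_interior:
  assumes M: "0 < M" and R1: "2 * M < R1" and le: "R1 \<le> x_crit M R" and R: "R1 < R"
  obtains c where "0 < c"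
    "\<And>r. R1 \<le> r \<Longrightarrow> r < R \<Longrightarrow> c * (r - x_crit M R)\<^sup>2 \<le> Psi M R r - Psi M R (x_crit M R)"
proof -
  define x where "x = x_crit M R"
  have R0: "0 < R" using assms by simp
  have x: "crit_poly M R x = 0" "2 * M < x" "x < R" using x_crit[of M R] assms x_def by auto
  obtain k where k: "0 < k" "\<And>r. R1 \<le> r \<Longrightarrow> r < R \<Longrightarrow> k \<le> Psi_weight M R r"
    using Psi_weight_ge[OF M R1 R] by blast
  \<comment> \<open>Chosen so that the slope \<open>2 * C * (r - x)\<close> of the parabola is
    \<open>k\<close> times the lower bound \<open>3 * R^3 * (r - x)\<close> for the cubic.\<close>
  define C where "C = k * 3 * R^3 / 2"
  have C2: "2 * C * y = k * (3 * R^3 * y)" for y by (simp add: C_def)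
  define g where "g r = Psi M R r - C * (r - x)\<^sup>2" for r
  have D: "(g has_real_derivative Psi_weight M R r * crit_poly M R r - 2 * C * (r - x)) (at r)"
    if "R1 \<le> r" "r < R" for r
    unfolding g_def
    by (rule derivative_eq_intros Psi_DERIV refl | use M that R1 in simp)+
  have "g x \<le> g r" if r: "R1 \<le> r" "r < R" for r
  proof (cases "x \<le> r")
    case True
    show ?thesis
    proof (rule DERIV_nonneg_imp_nondecreasing[OF True])
      fix s assume s: "x \<le> s" "s \<le> r"
      have "k * (3 * R^3 * (s - x)) \<le> Psi_weight M R s * crit_poly M R s"
        using k(1) k(2)[of s] s r le crit_poly_mono[OF M R0 s(1)] x R0 x_def by (intro mult_mono) auto
      then show "\<exists>y. (g has_real_derivative y) (at s) \<and> 0 \<le> y"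
        using D[of s] s r le x_def
        by (intro exI[of _ "Psi_weight M R s * crit_poly M R s - 2 * C * (s - x)"])
          (auto simp: C2 right_diff_distrib)
    qed
  next
    case False
    then have "r \<le> x" by simp
    then show ?thesis
    proof (rule DERIV_nonpos_imp_nonincreasing)
      fix s assume s: "r \<le> s" "s \<le> x"
      have "k * (3 * R^3 * (x - s)) \<le> Psi_weight M R s * (- crit_poly M R s)"
        using k(1) k(2)[of s] s r le crit_poly_mono[OF M R0 s(2)] x R0 by (intro mult_mono) auto
      then show "\<exists>y. (g has_real_derivative y) (at s) \<and> y \<le> 0"
        using D[of s] s r x
        by (intro exI[of _ "Psi_weight M R s * crit_poly M R s - 2 * C * (s - x)"])
          (auto simp: C2 right_diff_distrib)
    qed
  qed
  moreover have "C > 0" using k R0 by (simp add: C_def)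
  ultimately have "0 < C" "\<And>r. R1 \<le> r \<Longrightarrow> r < R \<Longrightarrow> C * (r - x)\<^sup>2 \<le> Psi M R r - Psi M R x"
    by (auto simp: g_def algebra_simps)
  then show ?thesis using that unfolding x_def by blast
qed

text \<open>To the right of \<open>x0\<close> the cubic is at least
  \<open>crit_poly M R R1 > 0\<close>, so \<open>Psi\<close> has a uniformly positive slope on
  \<open>[R1, R)\<close>. This lower bound degenerates as \<open>R1\<close> approaches
  \<open>x0\<close>.\<close>

lemma Psi_growth_boundary:
  assumes M: "0 < M" and R1: "2 * M < R1" and lt: "x_crit M R < R1" and R: "R1 < R"
  obtains c where "0 < c"
    "\<And>r. R1 \<le> r \<Longrightarrow> r < R \<Longrightarrow> c * (r - R1) \<le> Psi M R r - Psi M R R1"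
proof -
  define x where "x = x_crit M R"
  have R0: "0 < R" using assms by simp
  have x: "crit_poly M R x = 0" "x < R1" using x_crit[of M R] assms x_def by auto
  then have p: "crit_poly M R R1 > 0"
    using crit_poly_mono[OF M R0, of x R1] R0 by (smt (verit) mult_pos_pos zero_less_power)
  obtain k where k: "0 < k" "\<And>r. R1 \<le> r \<Longrightarrow> r < R \<Longrightarrow> k \<le> Psi_weight M R r"
    using Psi_weight_ge[OF M R1 R] by blast
  define C where "C = k * crit_poly M R R1"
  define g where "g r = Psi M R r - C * (r - R1)" for r
  have D: "(g has_real_derivative Psi_weight M R r * crit_poly M R r - C) (at r)"
    if "R1 \<le> r" "r < R" for r
    unfolding g_def
    by (rule derivative_eq_intros Psi_DERIV refl | use M that R1 in simp)+
  have "g R1 \<le> g r" if r: "R1 \<le> r" "r < R" for r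
  proof (rule DERIV_nonneg_imp_nondecreasing[OF r(1)])
    fix s assume s: "R1 \<le> s" "s \<le> r"
    have "0 \<le> 3 * R^3 * (s - R1)" using R0 s by simp
    then have "crit_poly M R R1 \<le> crit_poly M R s"
      using crit_poly_mono[OF M R0 s(1)] by linarith
    then have "C \<le> Psi_weight M R s * crit_poly M R s" unfolding C_def
      using k(1) k(2)[of s] s r p by (intro mult_mono) auto
    then show "\<exists>y. (g has_real_derivative y) (at s) \<and> 0 \<le> y"
      using D[of s] s r by (intro exI[of _ "Psi_weight M R s * crit_poly M R s - C"]) auto
  qed
  moreover have "C > 0" using k p by (simp add: C_def)
  ultimately have "0 < C" "\<And>r. R1 \<le> r \<Longrightarrow> r < R \<Longrightarrow> C * (r - R1) \<le> Psi M R r - Psi M R R1"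
    by (auto simp: g_def algebra_simps)
  then show ?thesis using that by blast
qed

text \<open>Passing from \<open>\<Psi>\<close> to \<open>q = \<Psi> A\<close> loses the factor \<open>A\<close>, which vanishes at \<open>R\<close>; where \<open>A\<close> is
  small, the lower bound comes from \<open>q\<close> alone.\<close>

lemma q_fun_minus_A_fun_ge:
  assumes M: "0 < M" and R1: "2 * M < R1" and l: "0 < l" and c: "0 < c"
    and d: "\<And>r. R1 \<le> r \<Longrightarrow> r \<le> R \<Longrightarrow> 0 \<le> d r \<and> d r \<le> D"
    and growth: "\<And>r. R1 \<le> r \<Longrightarrow> r < R \<Longrightarrow> c * d r \<le> Psi M R r - l"
  obtains c' where "0 < c'"
    "\<And>r. R1 \<le> r \<Longrightarrow> r \<le> R \<Longrightarrow> c' * d r \<le> q_fun M r - l * A_fun R r"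
proof -
  define D' where "D' = max D 1"
  \<comment> \<open>One entry for each case. If \<open>l * A\<close> is at most half of the bound
    \<open>R1^3\<close> for \<open>q\<close>, the other half remains and \<open>d\<close> is at most
    \<open>D'\<close>. Otherwise \<open>A > R1^3 / (2 * l)\<close>, and the growth of
    \<open>Psi\<close> is multiplied by \<open>A\<close>.\<close>
  define c' where "c' = min (R1^3 / (2 * D')) (R1^3 / (2 * l) * c)"
  have R0: "0 < R1" using M R1 by simp
  have D': "D' > 0" by (simp add: D'_def)
  have c': "c' > 0" unfolding c'_def using R0 D' l c by simp
  have "c' * d r \<le> q_fun M r - l * A_fun R r" if r: "R1 \<le> r" "r \<le> R" for r
  proof -
    have "R1^3 \<le> r^3" using R0 r by (intro power_mono) auto
    also have "\<dots> \<le> q_fun M r" using q_fun_ge M R1 r by simp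
    finally have q: "R1^3 \<le> q_fun M r" .
    have dr: "0 \<le> d r" "d r \<le> D'" using d[OF r] by (auto simp: D'_def)
    show ?thesis
    proof (cases "l * A_fun R r \<le> R1^3 / 2")
      case True
      have "c' * d r \<le> R1^3 / (2 * D') * D'"
        using dr R0 D' by (intro mult_mono) (auto simp: c'_def)
      then show ?thesis using True q D' by simp
    next
      case False
      then have A: "A_fun R r > R1^3 / (2 * l)" using l by (simp add: field_simps)
      have A0: "A_fun R r > 0" using A R0 l by (smt (verit) divide_pos_pos zero_less_power)
      then have "r \<noteq> R" by (auto simp: A_fun_def)
      then have g: "c * d r \<le> Psi M R r - l" using growth r by simp
      have "c' * d r \<le> (R1^3 / (2 * l) * c) * d r"
        using dr by (intro mult_right_mono) (auto simp: c'_def)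
      also have "\<dots> \<le> A_fun R r * (c * d r)"
        unfolding mult.assoc using A dr c by (intro mult_right_mono) auto
      also have "\<dots> \<le> A_fun R r * (Psi M R r - l)" using g A0 by (intro mult_left_mono) auto
      also have "\<dots> = q_fun M r - l * A_fun R r" using A0 by (simp add: Psi_def field_simps)
      finally show ?thesis .
    qed
  qed
  with c' show ?thesis using that by blast
qed

section \<open>The calibration inequality and the lower bound for smooth densities\<close>

lemma FTC_lebesgue:
  fixes f :: "real \<Rightarrow> real"
  assumes "a \<le> b" "\<And>x. (f has_real_derivative f' x) (at x)" "continuous_on {a..b} f'"
  shows "set_integrable lebesgue {a..b} f'" "(LINT x:{a..b}|lebesgue. f' x) = f b - f a"
proof -
  show i: "set_integrable lebesgue {a..b} f'"
    using assms(3) by (rule absolutely_integrable_continuous_real)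
  have "(f' has_integral f b - f a) {a..b}"
    by (rule fundamental_theorem_of_calculus[OF assms(1)])
      (metis assms(2) has_field_derivative_at_within has_real_derivative_iff_has_vector_derivative)
  then show "(LINT x:{a..b}|lebesgue. f' x) = f b - f a"
    using set_lebesgue_integral_eq_integral(2)[OF i] by (simp add: integral_unique)
qed

locale shell =
  fixes M1 M2 R1 R2 :: real
  assumes M1: "0 < M1" and M12: "M1 < M2" and R1: "2 * M2 < R1" and R12: "R1 < R2"
begin

lemma R1_pos: "0 < R1" using M1 M12 R1 by simp
lemma R2_pos: "0 < R2" using R1_pos R12 by simp
lemma M1_R1: "2 * M1 < R1" using M12 R1 by simp
lemma M1_R2: "2 * M1 < R2" using M1_R1 R12 by simp

abbreviation "x0 \<equiv> x_crit M1 R2"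
abbreviation "a \<equiv> a_opt M1 R1 R2"
abbreviation "l \<equiv> lambda_opt M1 R1 R2"

lemma a_bounds: "R1 \<le> a" "a < R2" "x0 \<le> a"
  using x_crit(3)[OF M1 M1_R2] R12 by (auto simp: a_opt_def)

lemma l_pos: "0 < l"
  unfolding lambda_opt_def using Psi_pos a_bounds M1 M1_R1 by simp

lemma q_minus_lA_interior:
  assumes "R1 \<le> x0"
  obtains c where "0 < c"
    "\<And>r. R1 \<le> r \<Longrightarrow> r \<le> R2 \<Longrightarrow> c * (r - a)\<^sup>2 \<le> q_fun M1 r - l * A_fun R2 r"
proof -
  have a: "a = x0" using assms by (simp add: a_opt_def)
  obtain c where c: "0 < c"
    "\<And>r. R1 \<le> r \<Longrightarrow> r < R2 \<Longrightarrow> c * (r - x0)\<^sup>2 \<le> Psi M1 R2 r - Psi M1 R2 x0"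
    using Psi_growth_interior[OF M1 M1_R1 assms R12] by blast
  have "(r - a)\<^sup>2 \<le> (R2 - R1)\<^sup>2" if "R1 \<le> r" "r \<le> R2" for r
    by (rule abs_le_square_iff[THEN iffD1]) (use that a_bounds in auto)
  then obtain c' where "0 < c'"
    "\<And>r. R1 \<le> r \<Longrightarrow> r \<le> R2 \<Longrightarrow> c' * (r - a)\<^sup>2 \<le> q_fun M1 r - l * A_fun R2 r"
    using q_fun_minus_A_fun_ge[OF M1 M1_R1 l_pos c(1), of R2 "\<lambda>r. (r - a)\<^sup>2" "(R2 - R1)\<^sup>2"] c(2)
    unfolding lambda_opt_def a by auto
  then show ?thesis using that by blast
qed

lemma q_minus_lA_boundary:
  assumes "x0 < R1"
  obtains c where "0 < c"
    "\<And>r. R1 \<le> r \<Longrightarrow> r \<le> R2 \<Longrightarrow> c * \<bar>r - a\<bar> \<le> q_fun M1 r - l * A_fun R2 r"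
proof -
  have a: "a = R1" using assms by (simp add: a_opt_def)
  obtain c where c: "0 < c"
    "\<And>r. R1 \<le> r \<Longrightarrow> r < R2 \<Longrightarrow> c * (r - R1) \<le> Psi M1 R2 r - Psi M1 R2 R1"
    using Psi_growth_boundary[OF M1 M1_R1 assms R12] by blast
  obtain c' where "0 < c'"
    "\<And>r. R1 \<le> r \<Longrightarrow> r \<le> R2 \<Longrightarrow> c' * \<bar>r - a\<bar> \<le> q_fun M1 r - l * A_fun R2 r"
    using q_fun_minus_A_fun_ge[OF M1 M1_R1 l_pos c(1), of R2 "\<lambda>r. \<bar>r - a\<bar>" "R2 - R1"] c(2)
    unfolding lambda_opt_def a by auto
  then show ?thesis using that by blast
qed

text \<open>The pointwise dual certificate: integrated against the rise of \<open>u\<close> and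
  combined with the mass constraint, it makes \<open>l\<close> a lower bound. Equality holds at
  \<open>a\<close>.\<close>

lemma lA_le_q:
  assumes "R1 \<le> r" "r \<le> R2"
  shows "l * A_fun R2 r \<le> q_fun M1 r"
proof (cases "R1 \<le> x0")
  case True
  obtain c where "0 < c" "c * (r - a)\<^sup>2 \<le> q_fun M1 r - l * A_fun R2 r"
    using q_minus_lA_interior[OF True] assms by metis
  moreover have "0 \<le> c * (r - a)\<^sup>2" using \<open>0 < c\<close> by simp
  ultimately show ?thesis by linarith
next
  case False
  obtain c where "0 < c" "c * \<bar>r - a\<bar> \<le> q_fun M1 r - l * A_fun R2 r"
    using q_minus_lA_boundary False assms by (metis not_le)
  moreover have "0 \<le> c * \<bar>r - a\<bar>" using \<open>0 < c\<close> by simp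
  ultimately show ?thesis by linarith
qed

end

text \<open>The assumptions shared by smooth and BV densities, so that the bounds on
  \<open>F\<close> and on the weight serve both functionals.\<close>

locale shell_density = shell +
  fixes u :: "real \<Rightarrow> real"
  assumes integrable_mass: "set_integrable lebesgue {R1..R2} (\<lambda>r. r^2 * u r)"
    and nonneg: "AE r in lebesgue. 0 \<le> u r"
    and unit_mass: "(LINT r:{R1..R2}|lebesgue. r^2 * u r) = 1"
begin

abbreviation "P \<equiv> P_fun R1 u"
abbreviation "F \<equiv> F_fun M1 M2 R1 u"
abbreviation "W r \<equiv> r^3 / sqrt (F r)"

lemma P_mono:
  assumes "r \<le> s" "s \<le> R2"
  shows "P r \<le> P s"
  unfolding P_fun_def set_lebesgue_integral_def
proof (rule integral_mono_AE)
  have "set_integrable lebesgue {R1..t} (\<lambda>r. r^2 * u r)" if "t \<le> R2" for t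
    using set_integrable_subset[OF integrable_mass] that by auto
  then show "integrable lebesgue (\<lambda>x. indicat_real {R1..r} x *\<^sub>R (x^2 * u x))"
    "integrable lebesgue (\<lambda>x. indicat_real {R1..s} x *\<^sub>R (x^2 * u x))"
    using assms unfolding set_integrable_def by auto
  show "AE x in lebesgue. indicat_real {R1..r} x *\<^sub>R (x^2 * u x) \<le> indicat_real {R1..s} x *\<^sub>R (x^2 * u x)"
    using nonneg by eventually_elim (use assms in \<open>auto simp: indicator_def\<close>)
qed

lemma P_bounds:
  assumes "r \<le> R2"
  shows "0 \<le> P r" "P r \<le> 1"
proof -
  have "P (min r (R1 - 1)) = 0" by (simp add: P_fun_def set_lebesgue_integral_def)
  then show "0 \<le> P r" using P_mono[of "min r (R1 - 1)" r] assms by simp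
  show "P r \<le> 1" using P_mono[OF assms] unit_mass by (simp add: P_fun_def)
qed

text \<open>The worst case for \<open>F\<close>: the full mass \<open>M2\<close> already enclosed at
  the innermost radius. It is positive since \<open>R1 > 2 * M2\<close>, and it keeps the weight
  bounded.\<close>

definition "Fmin = 1 - 2 * M2 / R1"

lemma Fmin_pos: "0 < Fmin" using R1 R1_pos by (simp add: Fmin_def)

lemma F_bounds:
  assumes "R1 \<le> r" "r \<le> R2"
  shows "Fmin \<le> F r" "F r \<le> 1 - 2 * M1 / r"
proof -
  have r: "0 < r" using R1_pos assms by simp
  have p: "0 \<le> (M2 - M1) * P r" "(M2 - M1) * P r \<le> (M2 - M1)"
    using P_bounds[OF assms(2)] M12 by (auto intro: mult_left_le)
  have "2 * (M1 + (M2 - M1) * P r) / r \<le> 2 * M2 / R1"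
    using p assms R1_pos M1 by (intro frac_le) auto
  then show "Fmin \<le> F r" by (simp add: Fmin_def F_fun_def)
  show "F r \<le> 1 - 2 * M1 / r"
    using p r by (simp add: F_fun_def divide_right_mono)
qed

lemma W_ge:
  assumes "R1 \<le> r" "r \<le> R2"
  shows "q_fun M1 r \<le> W r"
proof -
  have "0 < r" using R1_pos assms by simp
  then show ?thesis
    using F_bounds[OF assms] Fmin_pos M1_R1 assms q_fun_alt[OF M1, of r]
    by (auto intro!: divide_left_mono mult_pos_pos)
qed

lemma W_bounds:
  assumes "R1 \<le> r" "r \<le> R2"
  shows "0 < W r" "W r \<le> R2^3 / sqrt Fmin"
proof -
  have "0 < r" using R1_pos assms by simp
  then show "0 < W r" "W r \<le> R2^3 / sqrt Fmin"
    using F_bounds[OF assms] Fmin_pos assms by (auto intro!: frac_le power_mono)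
qed

text \<open>Borel rather than Lebesgue measurability, because the weight is also integrated against
  \<open>D_pos u\<close>.\<close>

lemma W_measurable: "(\<lambda>r. indicator {R1..R2} r * W r) \<in> borel_measurable borel"
proof -
  \<comment> \<open>Monotonicity of \<open>P\<close> is available only up to \<open>R2\<close>;
    freezing the argument there gives a globally monotone, hence Borel, function.\<close>
  have "mono (\<lambda>r. P (min r R2))"
    by (rule monoI) (rule P_mono, auto)
  then have [measurable]: "(\<lambda>r. P (min r R2)) \<in> borel_measurable borel"
    by (rule borel_measurable_mono)
  have "(\<lambda>r. indicator {R1..R2} r * W r)
      = (\<lambda>r. indicator {R1..R2} r * (r^3 / sqrt (1 - 2 * (M1 + (M2 - M1) * P (min r R2)) / r)))"
    by (auto simp: fun_eq_iff indicator_def F_fun_def)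
  then show ?thesis by simp
qed

end

lemma A_smooth_shell_density:
  assumes "shell M1 M2 R1 R2" "u \<in> A_smooth R1 R2"
  shows "shell_density M1 M2 R1 R2 u"
proof -
  interpret shell M1 M2 R1 R2 by fact
  show ?thesis
  proof
    show "set_integrable lebesgue {R1..R2} (\<lambda>r. r^2 * u r)"
      by (intro absolutely_integrable_continuous_real continuous_intros smooth_continuous_on)
        (use assms(2) in \<open>auto simp: A_smooth_def\<close>)
  qed (use assms(2) in \<open>auto simp: A_smooth_def\<close>)
qed

context shell begin

text \<open>For smooth \<open>u\<close> the Fubini argument is an integration by parts: (A u)' = A
  u' - r^2 u, and \<open>u\<close> vanishes at both ends, so the integral of A u' is 1. Pointwise, l
  A u' \<le> l A (u')_+ \<le> W (u')_+.\<close>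

lemma I_fun_ge:
  assumes u: "u \<in> A_smooth R1 R2"
  shows "l \<le> I_fun M1 M2 R1 R2 u"
proof -
  interpret shell_density M1 M2 R1 R2 u
    using A_smooth_shell_density[OF shell_axioms u] .
  have sm: "smooth u" and supp: "supp u \<subseteq> {R1<..<R2}" using u by (auto simp: A_smooth_def)
  have ends: "u R1 = 0" "u R2 = 0"
    using supp closure_subset[of "{x. u x \<noteq> 0}"] by (auto simp: supp_def)
  have cu: "continuous_on S u" "continuous_on S (deriv u)" for S
    using sm smooth_continuous_on smooth_deriv by auto
  define g where "g r = l * A_fun R2 r * deriv u r" for r
  have ig: "set_integrable lebesgue {R1..R2} g"
    unfolding g_def
    by (intro absolutely_integrable_continuous_real continuous_intros cu A_fun_continuous_on)
  have Dl: "((\<lambda>r. l * (A_fun R2 r * u r)) has_real_derivative g r - l * (r^2 * u r)) (at r)" for r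
    unfolding g_def
    by (rule derivative_eq_intros A_fun_DERIV smooth_DERIV[OF sm] refl)+ (simp add: algebra_simps)
  have "(LINT r:{R1..R2}|lebesgue. g r - l * (r^2 * u r)) = 0"
  proof (subst FTC_lebesgue(2)[OF _ Dl])
    show "continuous_on {R1..R2} (\<lambda>r. g r - l * (r^2 * u r))"
      unfolding g_def by (intro continuous_intros cu A_fun_continuous_on)
  qed (use R12 ends in auto)
  then have gl: "(LINT r:{R1..R2}|lebesgue. g r) = l"
    using set_integral_diff(2)[OF ig set_integrable_mult_right[OF integrable_mass, of l]] unit_mass
    by simp
  define w where "w r = W r * max (deriv u r) 0" for r
  \<comment> \<open>Integrability is essential for the comparison: the integral of a non-integrable
    function is 0 by convention.\<close>
  have iw: "set_integrable lebesgue {R1..R2} w"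
  proof (rule set_integrable_bound)
    show "set_integrable lebesgue {R1..R2} (\<lambda>r. R2^3 / sqrt Fmin * max (deriv u r) 0)"
      by (intro absolutely_integrable_continuous_real continuous_intros cu)
    have [measurable]: "deriv u \<in> borel_measurable borel"
      using cu(2) by (rule borel_measurable_continuous_onI)
    have "(\<lambda>r. indicator {R1..R2} r * W r * max (deriv u r) 0) \<in> borel_measurable borel"
      using W_measurable by measurable
    then show "set_borel_measurable lebesgue {R1..R2} w"
      unfolding set_borel_measurable_def w_def by (intro measurable_completion) (simp add: mult.assoc)
    show "AE x in lebesgue. x \<in> {R1..R2} \<longrightarrow> norm (w x) \<le> norm (R2^3 / sqrt Fmin * max (deriv u x) 0)"
    proof (intro AE_I2 impI)
      fix x assume "x \<in> {R1..R2}"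
      then have "0 < W x" "W x \<le> R2^3 / sqrt Fmin" using W_bounds by auto
      then have "\<bar>W x\<bar> \<le> \<bar>R2^3 / sqrt Fmin\<bar>" by linarith
      then show "norm (w x) \<le> norm (R2^3 / sqrt Fmin * max (deriv u x) 0)"
        unfolding w_def real_norm_def abs_mult by (rule mult_right_mono) simp
    qed
  qed
  have "l = (LINT r:{R1..R2}|lebesgue. g r)" using gl by simp
  also have "\<dots> \<le> (LINT r:{R1..R2}|lebesgue. w r)"
  proof (rule set_integral_mono[OF ig iw])
    fix r assume r: "r \<in> {R1..R2}"
    have 0: "0 \<le> l * A_fun R2 r" using r l_pos R1_pos A_fun_nonneg[of r R2] by simp
    have "g r \<le> l * A_fun R2 r * max (deriv u r) 0"
      unfolding g_def using 0 by (intro mult_left_mono) auto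
    also have "\<dots> \<le> w r"
      unfolding w_def using lA_le_q[of r] W_ge[of r] r by (intro mult_right_mono) auto
    finally show "g r \<le> w r" .
  qed
  also have "\<dots> = I_fun M1 M2 R1 R2 u"
    by (simp add: I_fun_def w_def mult.commute)
  finally show ?thesis .
qed

end

section \<open>Trial densities and the value of \<open>\<Lambda>\<close>\<close>

context shell begin

text \<open>The density rises on \<open>[p + e, p + 2 e]\<close> and falls on \<open>[R\<^sub>2 - 2 e, R\<^sub>2 - e]\<close>; its plateau height is at
  most \<open>h\<close>, so the mass accumulated while it rises is at most \<open>h R\<^sub>2\<^sup>2 e\<close>.\<close>

lemma trial_density_exists:
  assumes e: "0 < e" and p: "R1 \<le> p" and pR: "p + 2 * e < R2 - 2 * e"
    and h: "h = 3 / ((R2 - 2 * e)^3 - (p + 2 * e)^3)"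
    and F: "F = 1 - 2 * (M1 + (M2 - M1) * (h * R2\<^sup>2 * e)) / (p + e)" "0 < F"
  obtains u where "u \<in> A_smooth R1 R2" "I_fun M1 M2 R1 R2 u \<le> (p + 2 * e)^3 / sqrt F * h"
proof -
  obtain \<theta> :: "real \<Rightarrow> real" where \<theta>: "smooth \<theta>" "mono \<theta>"
    "\<And>x. x \<le> 0 \<Longrightarrow> \<theta> x = 0" "\<And>x. 1 \<le> x \<Longrightarrow> \<theta> x = 1" "\<And>x. deriv \<theta> x \<ge> 0"
    "\<And>x. x \<notin> {0<..<1} \<Longrightarrow> deriv \<theta> x = 0"
    and \<theta>01: "\<And>x. 0 \<le> \<theta> x" "\<And>x. \<theta> x \<le> 1"
    using smooth_step_exists by blast
  have p0: "0 < p" using p R1_pos by simp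
  define rise where "rise r = \<theta> ((r - (p + e)) / e)" for r
  define fall where "fall r = \<theta> ((r - (R2 - 2 * e)) / e)" for r
  define v where "v r = rise r - fall r" for r
  have step_D: "((\<lambda>r. \<theta> ((r - s) / e)) has_real_derivative deriv \<theta> ((r - s) / e) / e) (at r)" for r s
  proof -
    have "((\<lambda>r. (r - s) / e) has_real_derivative 1 / e) (at r)"
      by (rule derivative_eq_intros refl | use e in simp)+
    from DERIV_chain2[OF smooth_DERIV[OF \<theta>(1)] this] show ?thesis by simp
  qed
  have rise_D: "(rise has_real_derivative deriv \<theta> ((r - (p + e)) / e) / e) (at r)" for r
    unfolding rise_def by (rule step_D)
  have fall_D: "(fall has_real_derivative deriv \<theta> ((r - (R2 - 2 * e)) / e) / e) (at r)" for r
    unfolding fall_def by (rule step_D)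
  have step_smooth: "smooth (\<lambda>r. \<theta> ((r - s) / e))" for s
    using smooth_affine[OF \<theta>(1), of 1 "1 / e" "- (s / e)"] by (simp add: diff_divide_distrib)
  have sm: "smooth rise" "smooth fall"
    unfolding rise_def fall_def by (rule step_smooth)+
  have smv: "smooth (\<lambda>r. c * v r)" for c
    using smooth_add[OF smooth_affine[OF sm(1), of c 1 0] smooth_affine[OF sm(2), of "- c" 1 0]]
    by (simp add: v_def right_diff_distrib)
  have rise0: "rise r = 0" if "r \<le> p + e" for r
    unfolding rise_def by (rule \<theta>(3)) (use that e in \<open>simp add: divide_nonpos_pos\<close>)
  have rise1: "rise r = 1" if "p + 2 * e \<le> r" for r
    unfolding rise_def by (rule \<theta>(4)) (use that e in \<open>simp add: le_divide_eq\<close>)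
  have fall0: "fall r = 0" if "r \<le> R2 - 2 * e" for r
    unfolding fall_def by (rule \<theta>(3)) (use that e in \<open>simp add: divide_nonpos_pos\<close>)
  have fall1: "fall r = 1" if "R2 - e \<le> r" for r
    unfolding fall_def by (rule \<theta>(4)) (use that e in \<open>simp add: le_divide_eq\<close>)
  have v01: "0 \<le> v r" "v r \<le> 1" for r
  proof -
    \<comment> \<open>Rise and fall are translates of one monotone step and the fall comes later, so
      their difference is nonnegative.\<close>
    have "(r - (R2 - 2 * e)) / e \<le> (r - (p + e)) / e"
      using e pR by (intro divide_right_mono) auto
    then show "0 \<le> v r" unfolding v_def rise_def fall_def using monoD[OF \<theta>(2)] by simp
    show "v r \<le> 1"
      unfolding v_def rise_def fall_def
      using \<theta>01[of "(r - (R2 - 2 * e)) / e"] \<theta>01[of "(r - (p + e)) / e"] by linarith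
  qed
  have v_out: "v r = 0" if "r \<notin> {p + e..R2 - e}" for r
  proof (cases "r < p + e")
    case True
    then show ?thesis using e pR rise0[of r] fall0[of r] by (simp add: v_def)
  next
    case False
    then have "R2 - e < r" using that by simp
    then show ?thesis using e pR rise1[of r] fall1[of r] by (simp add: v_def)
  qed
  have v_plateau: "v r = 1" if "r \<in> {p + 2 * e..R2 - 2 * e}" for r
    using that rise1[of r] fall0[of r] by (simp add: v_def)
  define N where "N = (LINT r:{R1..R2}|lebesgue. r^2 * v r)"
  have ci: "continuous_on S (\<lambda>r. r^2 * v r)" for S
    using smooth_continuous_on[OF smv[of 1]] by (intro continuous_intros) simp
  have iv: "set_integrable lebesgue {s..t} (\<lambda>r. r^2 * v r)" for s t
    by (rule absolutely_integrable_continuous_real) (rule ci)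
  have cube: "(LINT r:{s..t}|lebesgue. r^2) = (t^3 - s^3) / 3" if "s \<le> t" for s t :: real
    by (subst FTC_lebesgue(2)[OF that, of "\<lambda>r. r^3 / 3"])
      (auto intro!: derivative_eq_intros continuous_intros simp: diff_divide_distrib)
  have cube_pos: "(R2 - 2 * e)^3 - (p + 2 * e)^3 > 0"
    using pR p0 e by (simp add: power_strict_mono)
  \<comment> \<open>The plateau alone carries this much mass and the flanks only add to it. Hence
    the normalising factor \<open>1 / N\<close> is at most \<open>h\<close>.\<close>
  have N: "((R2 - 2 * e)^3 - (p + 2 * e)^3) / 3 \<le> N"
  proof -
    have "((R2 - 2 * e)^3 - (p + 2 * e)^3) / 3 = (LINT r:{p + 2 * e..R2 - 2 * e}|lebesgue. r^2)"
      using cube[of "p + 2 * e" "R2 - 2 * e"] pR by simp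
    also have "\<dots> = (LINT r:{p + 2 * e..R2 - 2 * e}|lebesgue. r^2 * v r)"
      by (rule set_lebesgue_integral_cong) (auto simp: v_plateau)
    also have "\<dots> \<le> N" unfolding N_def set_lebesgue_integral_def
      by (rule integral_mono[OF iv[unfolded set_integrable_def] iv[unfolded set_integrable_def]])
        (use v01 p e in \<open>auto simp: indicator_def\<close>)
    finally show ?thesis .
  qed
  have N0: "0 < N" by (rule less_le_trans[OF _ N]) (rule divide_pos_pos[OF cube_pos], simp)
  have h0: "0 < h" unfolding h by (rule divide_pos_pos[OF _ cube_pos]) simp
  define k where "k = 1 / N"
  have k0: "0 < k" using N0 by (simp add: k_def)
  have "k \<le> 1 / (((R2 - 2 * e)^3 - (p + 2 * e)^3) / 3)"
    unfolding k_def by (rule divide_left_mono[OF N]) (use N0 cube_pos in \<open>auto intro!: mult_pos_pos divide_pos_pos\<close>)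
  then have k: "0 < k" "k \<le> h" using k0 h by simp_all
  define u where "u r = k * v r" for r
  have uA: "u \<in> A_smooth R1 R2"
  proof -
    have "supp u \<subseteq> {p + e..R2 - e}" unfolding supp_def
    proof (rule closure_minimal)
      show "{x. u x \<noteq> 0} \<subseteq> {p + e..R2 - e}" using v_out by (auto simp: u_def simp del: atLeastAtMost_iff)
    qed simp
    then have "supp u \<subseteq> {R1<..<R2}" by (rule order_trans) (use e p in auto)
    moreover have "(LINT r:{R1..R2}|lebesgue. r^2 * u r) = 1"
    proof -
      have "(LINT r:{R1..R2}|lebesgue. r^2 * u r) = (LINT r:{R1..R2}|lebesgue. k * (r^2 * v r))"
        by (simp add: u_def mult_ac)
      also have "\<dots> = k * N" unfolding N_def by (rule set_integral_mult_right)
      finally show ?thesis using N0 by (simp add: k_def)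
    qed
    ultimately show ?thesis using smv[of k] v01 k by (simp add: A_smooth_def u_def[abs_def])
  qed
  interpret shell_density M1 M2 R1 R2 u
    by (rule A_smooth_shell_density[OF shell_axioms uA])
  have P_le: "P r \<le> h * R2\<^sup>2 * e" if r: "r \<in> {p + e..p + 2 * e}" for r
  proof -
    have "P r \<le> P (p + 2 * e)" using r pR e by (intro P_mono) auto
    also have "\<dots> \<le> (LINT r:{p + e..p + 2 * e}|lebesgue. h * R2\<^sup>2)"
      unfolding P_fun_def set_lebesgue_integral_def
    proof (rule integral_mono')
      show "integrable lebesgue (\<lambda>r. indicat_real {p + e..p + 2 * e} r *\<^sub>R (h * R2\<^sup>2))"
        using absolutely_integrable_continuous_real[of "p + e" "p + 2 * e" "\<lambda>_. h * R2\<^sup>2"]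
        by (simp add: set_integrable_def)
      fix r :: real
      show "0 \<le> indicat_real {p + e..p + 2 * e} r *\<^sub>R (h * R2\<^sup>2)" using h0 by simp
      show "indicat_real {R1..p + 2 * e} r *\<^sub>R (r\<^sup>2 * u r) \<le> indicat_real {p + e..p + 2 * e} r *\<^sub>R (h * R2\<^sup>2)"
      proof (cases "r \<in> {p + e..p + 2 * e}")
        case True
        have "k * v r \<le> k * 1" using v01[of r] k by (intro mult_left_mono) auto
        then have "u r \<le> h" using k unfolding u_def by linarith
        moreover have "r\<^sup>2 \<le> R2\<^sup>2" using True pR p0 e by (intro power_mono) auto
        ultimately have "r\<^sup>2 * u r \<le> R2\<^sup>2 * h" using v01[of r] k by (intro mult_mono) (auto simp: u_def)
        then show ?thesis using True h0 by (simp add: indicator_def mult.commute)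
      next
        case False
        then have "r \<in> {R1..p + 2 * e} \<Longrightarrow> u r = 0" by (simp add: u_def v_out)
        then have "indicat_real {R1..p + 2 * e} r *\<^sub>R (r\<^sup>2 * u r) = 0" by (cases "r \<in> {R1..p + 2 * e}") simp_all
        moreover have "0 \<le> indicat_real {p + e..p + 2 * e} r *\<^sub>R (h * R2\<^sup>2)" using h0 by simp
        ultimately show ?thesis by linarith
      qed
    qed
    also have "\<dots> = h * R2\<^sup>2 * e"
      unfolding set_lebesgue_integral_def using e by (subst integral_scaleR_left) auto
    finally show ?thesis .
  qed
  define K where "K = (p + 2 * e)^3 / sqrt F"
  have K0: "0 \<le> K" using p0 e F(2) by (simp add: K_def)
  have W_le: "W r \<le> K" if r: "r \<in> {p + e..p + 2 * e}" for r
  proof -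
    have "0 \<le> P r" using P_bounds(1) r pR e by simp
    then have "2 * (M1 + (M2 - M1) * P r) / r \<le> 2 * (M1 + (M2 - M1) * (h * R2\<^sup>2 * e)) / (p + e)"
      using P_le[OF r] r M1 M12 p0 e by (intro frac_le mult_left_mono add_left_mono) auto
    then have "F \<le> F_fun M1 M2 R1 u r" by (simp add: F_fun_def F(1))
    then show ?thesis unfolding K_def
      using F(2) r p0 e by (intro frac_le power_mono) auto
  qed
  have Du: "(u has_real_derivative
      k * (deriv \<theta> ((r - (p + e)) / e) / e - deriv \<theta> ((r - (R2 - 2 * e)) / e) / e)) (at r)" for r
    unfolding u_def v_def by (intro DERIV_cmult DERIV_diff rise_D fall_D)
  then have du: "deriv u r = k * (deriv \<theta> ((r - (p + e)) / e) / e - deriv \<theta> ((r - (R2 - 2 * e)) / e) / e)" for r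
    using DERIV_imp_deriv by blast
  define g where "g r = K * k * (deriv \<theta> ((r - (p + e)) / e) / e)" for r
  have cg: "continuous_on S g" for S
    unfolding g_def
    by (intro continuous_intros continuous_on_compose2[OF smooth_continuous_on[OF smooth_deriv[OF \<theta>(1)], of UNIV]])
      (use e in auto)
  have Dg: "((\<lambda>r. K * k * rise r) has_real_derivative g r) (at r)" for r
    unfolding g_def by (intro DERIV_cmult rise_D)
  have "I_fun M1 M2 R1 R2 u \<le> (LINT r:{R1..R2}|lebesgue. g r)"
    unfolding I_fun_def set_lebesgue_integral_def
  proof (rule integral_mono')
    show "integrable lebesgue (\<lambda>r. indicat_real {R1..R2} r *\<^sub>R g r)"
      using FTC_lebesgue(1)[OF _ Dg cg, of R1 R2] R12 by (simp add: set_integrable_def)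
    fix r
    have g0: "0 \<le> g r" unfolding g_def using K0 k \<theta>(5) e by simp
    then show "0 \<le> indicat_real {R1..R2} r *\<^sub>R g r" by simp
    show "indicat_real {R1..R2} r *\<^sub>R (r^3 * max (deriv u r) 0 / sqrt (F_fun M1 M2 R1 u r))
        \<le> indicat_real {R1..R2} r *\<^sub>R g r"
    proof (cases "r \<in> {R1..R2} \<and> deriv u r > 0")
      case True
      define t where "t = (r - (p + e)) / e"
      \<comment> \<open>The falling step enters \<open>deriv u\<close> with a negative sign, so
        where \<open>deriv u\<close> is positive the rising step must be active. This confines
        \<open>r\<close> to the rising flank, where the weight is at most \<open>K\<close>.\<close>
      have "deriv \<theta> t \<noteq> 0"
        using True \<theta>(5)[of "(r - (R2 - 2 * e)) / e"] k e
        by (auto simp: du t_def[symmetric] mult_less_0_iff zero_less_mult_iff divide_less_0_iff)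
      then have "t \<in> {0<..<1}" using \<theta>(6) by blast
      then have r: "r \<in> {p + e..p + 2 * e}" using e by (simp add: t_def field_simps)
      have "deriv u r \<le> k * (deriv \<theta> t / e)"
        unfolding du t_def using k \<theta>(5) e by (intro mult_left_mono) auto
      then have "W r * deriv u r \<le> K * (k * (deriv \<theta> t / e))"
        using W_le[OF r] True K0 by (intro mult_mono) auto
      then show ?thesis using True by (simp add: g_def t_def mult_ac)
    next
      case False
      then have "r \<in> {R1..R2} \<Longrightarrow> max (deriv u r) 0 = 0" by auto
      then show ?thesis using g0 by (cases "r \<in> {R1..R2}") (simp_all add: indicator_def)
    qed
  qed
  also have "\<dots> = K * k"
    using FTC_lebesgue(2)[OF _ Dg cg, of R1 R2] R12 pR p e
    by (simp add: rise0 rise1)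
  also have "\<dots> \<le> K * h" using k K0 by (intro mult_left_mono) auto
  finally show ?thesis using that[OF uA] by (simp add: K_def)
qed

text \<open>As \<open>e\<close> decreases to 0, the height bound tends to 1/A(a) and the mass
  accumulated during the rise to 0. The cost bound of the trial densities then tends to q(a)/A(a),
  which is \<open>l\<close>.\<close>

lemma Lambda_eq: "Lambda M1 M2 R2 R1 = l"
proof (rule antisym)
  define p where "p = a"
  have p: "R1 \<le> p" "p < R2" "0 < p" using a_bounds R1_pos by (auto simp: p_def)
  define h where "h e = 3 / ((R2 - 2 * e)^3 - (p + 2 * e)^3)" for e
  define F where "F e = 1 - 2 * (M1 + (M2 - M1) * (h e * R2\<^sup>2 * e)) / (p + e)" for e
  have A: "A_fun R2 p > 0" using p A_fun_pos by blast
  have h: "(h \<longlongrightarrow> 1 / A_fun R2 p) (at_right 0)"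
    unfolding h_def by (rule tendsto_eq_intros refl | use A in \<open>simp add: A_fun_def\<close>)+
  have F: "(F \<longlongrightarrow> 1 - 2 * M1 / p) (at_right 0)"
    unfolding F_def by (rule tendsto_eq_intros h refl | use p in simp)+
  have F0: "0 < 1 - 2 * M1 / p" using p M1_R1 by simp
  have "((\<lambda>e. (p + 2 * e)^3 / sqrt (F e) * h e)
      \<longlongrightarrow> (p + 2 * 0)^3 / sqrt (1 - 2 * M1 / p) * (1 / A_fun R2 p)) (at_right 0)"
    by (intro tendsto_intros F h) (use F0 in auto)
  then have lim: "((\<lambda>e. (p + 2 * e)^3 / sqrt (F e) * h e)
      \<longlongrightarrow> p^3 / sqrt (1 - 2 * M1 / p) * (1 / A_fun R2 p)) (at_right 0)"
    by simp
  have "eventually (\<lambda>e. e < (R2 - p) / 4) (at_right 0)"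
    by (rule eventually_at_right_field[THEN iffD2]) (use p in \<open>auto intro!: exI[of _ "(R2 - p) / 4"]\<close>)
  then have ev: "eventually (\<lambda>e. e > 0 \<and> e < (R2 - p) / 4 \<and> F e > 0) (at_right 0)"
    using order_tendstoD(1)[OF F F0] by (intro eventually_conj eventually_at_right_less)
  have ne: "\<exists>u\<in>A_smooth R1 R2. I_fun M1 M2 R1 R2 u \<le> (p + 2 * e)^3 / sqrt (F e) * h e"
    if "e > 0 \<and> e < (R2 - p) / 4 \<and> F e > 0" for e
    using trial_density_exists[of e p "h e" "F e"] that p unfolding h_def F_def by force
  have bdd: "bdd_below (I_fun M1 M2 R1 R2 ` A_smooth R1 R2)"
    using I_fun_ge by (auto intro!: bdd_belowI)
  have "Lambda M1 M2 R2 R1 \<le> p^3 / sqrt (1 - 2 * M1 / p) * (1 / A_fun R2 p)"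
  proof (rule tendsto_lowerbound[OF lim])
    show "\<forall>\<^sub>F e in at_right 0. Lambda M1 M2 R2 R1 \<le> (p + 2 * e)^3 / sqrt (F e) * h e"
      using ev
    proof eventually_elim
      case (elim e)
      then show ?case unfolding Lambda_def using ne[OF elim] cINF_lower[OF bdd] by force
    qed
  qed simp
  then show "Lambda M1 M2 R2 R1 \<le> l"
    using p M1_R1 by (simp add: lambda_opt_def Psi_def q_fun_alt[OF M1] p_def[symmetric])
  obtain e where "e > 0 \<and> e < (R2 - p) / 4 \<and> F e > 0"
    using eventually_happens'[OF _ ev] by force
  then have "A_smooth R1 R2 \<noteq> {}" using ne by blast
  then show "l \<le> Lambda M1 M2 R2 R1"
    unfolding Lambda_def by (rule cINF_greatest) (rule I_fun_ge)
qed

end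

lemma Lambda_eq_Psi:
  assumes "0 < M1" "M1 < M2" "2 * M2 < R1" "R1 < R2"
  shows "Lambda M1 M2 R2 R1 = Psi M1 R2 (max R1 (x_crit M1 R2))"
proof -
  interpret shell M1 M2 R1 R2 using assms by unfold_locales
  show ?thesis using Lambda_eq by (simp add: lambda_opt_def a_opt_def)
qed

section \<open>Regularity of the infimum at the critical radius\<close>

context
  fixes M1 M2 R2 :: real
  assumes M1: "0 < M1" and M12: "M1 < M2" and R2: "2 * M2 < R2" and x0: "2 * M2 < x_crit M1 R2"
begin

private abbreviation (input) "x \<equiv> x_crit M1 R2"
private abbreviation (input) "Psi' r \<equiv> Psi_weight M1 R2 r * crit_poly M1 R2 r"

private lemma x: "crit_poly M1 R2 x = 0" "x < R2"
  using x_crit[of M1 R2] M1 M12 R2 by auto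

private lemma Psi_D: "2 * M2 < r \<Longrightarrow> r < R2 \<Longrightarrow> (Psi M1 R2 has_real_derivative Psi' r) (at r)"
  using Psi_DERIV M1 M12 by simp

private lemma Lambda: "2 * M2 < r \<Longrightarrow> r < R2 \<Longrightarrow> Lambda M1 M2 R2 r = Psi M1 R2 (max r x)"
  using Lambda_eq_Psi M1 M12 by blast

text \<open>The derivative of \<open>Psi\<close> vanishes at \<open>x0\<close>, so the constant
  branch and the \<open>Psi\<close> branch meet with equal slope and one formula covers both
  phases.\<close>

private lemma Lambda_D:
  assumes y: "2 * M2 < y" "y < R2"
  shows "(Lambda M1 M2 R2 has_real_derivative Psi' (max y x)) (at y)"
proof -
  consider "y < x" | "x < y" | "y = x" by linarith
  then show ?thesis
  proof cases
    case 1
    have "((\<lambda>r. Psi M1 R2 x) has_real_derivative 0) (at y)" by simp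
    then have "(Lambda M1 M2 R2 has_real_derivative 0) (at y)"
      by (rule has_field_derivative_transform_within_open[of _ _ _ "{2 * M2<..<x}"])
        (use 1 y x Lambda in auto)
    then show ?thesis using 1 x by (simp add: max_def)
  next
    case 2
    have "(Lambda M1 M2 R2 has_real_derivative Psi' y) (at y)"
      by (rule has_field_derivative_transform_within_open[OF Psi_D[OF y], of "{x<..<R2}"])
        (use 2 y x0 Lambda in auto)
    then show ?thesis using 2 by (simp add: max_def)
  next
    case 3
    \<comment> \<open>At the junction the increment of \<open>Lambda\<close> is either 0 or that of
      \<open>Psi\<close>, so its difference quotient is dominated by one that tends to 0.\<close>
    have "((\<lambda>r. (Psi M1 R2 r - Psi M1 R2 x) / (r - x)) \<longlongrightarrow> 0) (at x)"
      using Psi_D[of x] x x0 by (simp add: has_field_derivative_iff)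
    then have "((\<lambda>r. (Lambda M1 M2 R2 r - Lambda M1 M2 R2 x) / (r - x)) \<longlongrightarrow> 0) (at x)"
    proof (rule Lim_null_comparison[OF _ tendsto_norm_zero, rotated])
      have "\<forall>\<^sub>F r in at x. r \<in> {2 * M2<..<R2}"
        by (rule eventually_at_in_open') (use x x0 in auto)
      then show "\<forall>\<^sub>F r in at x. norm ((Lambda M1 M2 R2 r - Lambda M1 M2 R2 x) / (r - x))
          \<le> norm ((Psi M1 R2 r - Psi M1 R2 x) / (r - x))"
        by eventually_elim (use Lambda x x0 in \<open>auto simp: max_def\<close>)
    qed
    then show ?thesis using 3 x by (simp add: has_field_derivative_iff)
  qed
qed

private lemma deriv_Lambda: "2 * M2 < y \<Longrightarrow> y < R2 \<Longrightarrow> deriv (Lambda M1 M2 R2) y = Psi' (max y x)"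
  using Lambda_D DERIV_imp_deriv by blast

lemma Lambda_C1: "Ck_at 1 (Lambda M1 M2 R2) x"
proof -
  have cPsi: "continuous_on {2 * M2<..<R2} (Psi M1 R2)"
    using Psi_D by (intro continuous_at_imp_continuous_on ballI DERIV_isCont) auto
  have "continuous_on {2 * M2<..<R2} Psi'"
    unfolding Psi_weight_def crit_poly_def
  proof (intro continuous_intros cPsi ballI)
    fix r assume "r \<in> {2 * M2<..<R2}"
    moreover then have "r^3 < R2^3" using M1 M12 by (intro power_strict_mono) auto
    ultimately show "r * (r - 2 * M1) * (R2^3 - r^3) \<noteq> 0" using M1 M12 by auto
  qed
  then have "continuous_on {2 * M2<..<R2} (\<lambda>y. Psi' (max y x))"
    by (rule continuous_on_compose2) (use x x0 in \<open>auto intro!: continuous_intros\<close>)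
  then have "continuous_on {2 * M2<..<R2} (deriv (Lambda M1 M2 R2))"
    by (rule continuous_on_eq) (use deriv_Lambda in auto)
  moreover have "Lambda M1 M2 R2 field_differentiable at y" if "y \<in> {2 * M2<..<R2}" for y
    using Lambda_D that field_differentiable_def by force
  ultimately show ?thesis
    unfolding Ck_at_def by (intro exI[of _ "{2 * M2<..<R2}"]) (use x x0 in auto)
qed

text \<open>The difference quotients of the first derivative at \<open>x0\<close> vanish from the
  left and are at least \<open>k * (3 * R2^3) > 0\<close> from the right, so the first derivative is
  not differentiable there.\<close>

lemma Lambda_not_C2: "\<not> Ck_at 2 (Lambda M1 M2 R2) x"
proof
  assume "Ck_at 2 (Lambda M1 M2 R2) x"
  then have "(deriv ^^ 1) (Lambda M1 M2 R2) field_differentiable at x"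
    unfolding Ck_at_def by (metis one_less_numeral_iff semiring_norm(76))
  then obtain d where "(deriv (Lambda M1 M2 R2) has_real_derivative d) (at x)"
    by (auto simp: field_differentiable_def)
  then have lim: "((\<lambda>y. deriv (Lambda M1 M2 R2) y / (y - x)) \<longlongrightarrow> d) (at x)"
    using deriv_Lambda[of x] x x0 by (simp add: has_field_derivative_iff)
  obtain k where k: "0 < k" "\<And>r. x \<le> r \<Longrightarrow> r < R2 \<Longrightarrow> k \<le> Psi_weight M1 R2 r"
    using Psi_weight_ge[of M1 x R2] M1 M12 x x0 by auto
  have "\<forall>\<^sub>F y in at_left x. deriv (Lambda M1 M2 R2) y / (y - x) = 0"
  proof -
    have "\<forall>\<^sub>F y in at_left x. y \<in> {2 * M2<..<x}"
      by (rule eventually_at_leftI[of "2 * M2"]) (use x0 in auto)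
    then show ?thesis
      by eventually_elim (use deriv_Lambda x in \<open>auto simp: max_def\<close>)
  qed
  then have "d = 0"
    using tendsto_unique[OF _ tendsto_mono[OF at_le lim] tendsto_eventually] by force
  have "\<forall>\<^sub>F y in at_right x. k * (3 * R2^3) \<le> deriv (Lambda M1 M2 R2) y / (y - x)"
  proof -
    have "\<forall>\<^sub>F y in at_right x. y \<in> {x<..<R2}"
      by (rule eventually_at_rightI[of _ R2]) (use x in auto)
    then show ?thesis
    proof eventually_elim
      case (elim y)
      have "k * (3 * R2^3 * (y - x)) \<le> Psi' y"
        using elim k(1) k(2)[of y] crit_poly_mono[of M1 R2 x y] x M1 M12 R2 by (intro mult_mono) auto
      then show ?case using elim deriv_Lambda[of y] x0 by (simp add: le_divide_eq max_def mult.assoc)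
    qed
  qed
  then have "k * (3 * R2^3) \<le> d"
    using tendsto_lowerbound[OF tendsto_mono[OF at_le lim]] by force
  then show False using \<open>d = 0\<close> k R2 M1 M12 by (auto simp: mult_le_0_iff)
qed

end

section \<open>Distributional derivatives\<close>

lemma test_function_bounded:
  assumes "smooth \<phi>" "compact (supp \<phi>)"
  obtains B where "\<And>x. \<bar>\<phi> x\<bar> \<le> B"
proof -
  have "compact (\<phi> ` supp \<phi>)"
    using assms smooth_continuous_on by (intro compact_continuous_image) auto
  then obtain B where B: "\<And>y. y \<in> \<phi> ` supp \<phi> \<Longrightarrow> \<bar>y\<bar> \<le> B"
    using compact_imp_bounded bounded_real by metis
  have "\<bar>\<phi> x\<bar> \<le> \<bar>B\<bar>" for x
  proof (cases "\<phi> x = 0")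
    case False
    then have "x \<in> supp \<phi>" unfolding supp_def using closure_subset by fastforce
    then show ?thesis using B by force
  qed simp
  then show ?thesis using that by blast
qed

lemma integrable_bounded_borel:
  fixes f :: "real \<Rightarrow> real"
  assumes "finite_measure \<mu>" "sets \<mu> = sets borel" "f \<in> borel_measurable borel" "\<And>x. \<bar>f x\<bar> \<le> B"
  shows "integrable \<mu> f"
proof (rule finite_measure.integrable_const_bound[OF assms(1)])
  show "AE x in \<mu>. norm (f x) \<le> B" using assms(4) by simp
  show "f \<in> borel_measurable \<mu>" using assms(3) measurable_cong_sets[OF assms(2) refl] by blast
qed

lemma integrable_test_function:
  assumes "finite_measure \<mu>" "sets \<mu> = sets borel" "smooth \<phi>" "compact (supp \<phi>)"
  shows "integrable \<mu> \<phi>"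
  using test_function_bounded[OF assms(3,4)] integrable_bounded_borel[OF assms(1,2)]
    borel_measurable_continuous_onI[OF smooth_continuous_on[OF assms(3)]] by metis

section \<open>Jordan decomposition\<close>

text \<open>A reference measure with respect to which both measures have densities. Their supremum
  is finite because it is bounded by the sum.\<close>

lemma common_dominating_measure:
  assumes "finite_measure \<mu>" "finite_measure \<nu>" "sets \<nu> = sets \<mu>"
  obtains \<tau> where "finite_measure \<tau>" "sets \<tau> = sets \<mu>"
    "absolutely_continuous \<tau> \<mu>" "absolutely_continuous \<tau> \<nu>"
proof
  let ?\<tau> = "sup_measure' \<mu> \<nu>"
  interpret \<mu>: finite_measure \<mu> by fact
  interpret \<nu>: finite_measure \<nu> by fact
  have sp: "space \<nu> = space \<mu>" using assms(3) sets_eq_imp_space_eq by blast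
  show sets: "sets ?\<tau> = sets \<mu>" using assms(3) by simp
  show "finite_measure ?\<tau>"
  proof
    have "emeasure ?\<tau> (space \<mu>) \<le> emeasure \<mu> (space \<mu>) + emeasure \<nu> (space \<mu>)"
      using assms(3) sp by (subst emeasure_sup_measure')
        (auto intro!: SUP_least add_mono emeasure_space emeasure_space[of \<nu>, unfolded sp])
    also have "\<dots> < \<infinity>" using \<mu>.emeasure_finite \<nu>.emeasure_finite by (simp add: less_top[symmetric])
    finally show "emeasure ?\<tau> (space ?\<tau>) \<noteq> \<infinity>" using assms(3) by simp
  qed
  show "absolutely_continuous ?\<tau> \<mu>"
    using le_emeasure_sup_measure'1[OF assms(3)] sets
    by (auto simp: absolutely_continuous_def null_sets_def) (metis le_zero_eq)
  show "absolutely_continuous ?\<tau> \<nu>"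
    using le_emeasure_sup_measure'2[OF assms(3)] sets assms(3)
    by (auto simp: absolutely_continuous_def null_sets_def) (metis le_zero_eq)
qed

text \<open>Ensures that the choice in \<open>D_pos\<close> is not vacuous. The common part of the
  two measures is cancelled pointwise, through their Radon-Nikodym densities.\<close>

lemma Jordan_decomposition:
  assumes u: "has_distr_deriv u \<mu> \<nu>"
  obtains \<mu>' \<nu>' where "has_distr_deriv u \<mu>' \<nu>'" "mutually_singular \<mu>' \<nu>'"
proof -
  have fin: "finite_measure \<mu>" "finite_measure \<nu>" and sets: "sets \<mu> = sets borel" "sets \<nu> = sets borel"
    and int: "\<And>\<phi>. smooth \<phi> \<Longrightarrow> compact (supp \<phi>) \<Longrightarrow>
      (LINT x|lebesgue. u x * deriv \<phi> x) = - ((LINT x|\<mu>. \<phi> x) - (LINT x|\<nu>. \<phi> x))"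
    using u by (auto simp: has_distr_deriv_def)
  obtain \<tau> where \<tau>: "finite_measure \<tau>" "sets \<tau> = sets \<mu>"
    "absolutely_continuous \<tau> \<mu>" "absolutely_continuous \<tau> \<nu>"
    using common_dominating_measure[OF fin] sets by auto
  interpret \<tau>: finite_measure \<tau> by fact
  have density: "\<exists>f. f \<in> borel_measurable \<tau> \<and> (\<forall>x. 0 \<le> f x) \<and> density \<tau> (\<lambda>x. ennreal (f x)) = \<rho>"
    if \<rho>: "finite_measure \<rho>" "absolutely_continuous \<tau> \<rho>" "sets \<rho> = sets \<tau>" for \<rho> :: "real measure"
  proof -
    obtain D where D: "D \<in> borel_measurable \<tau>" "AE x in \<tau>. RN_deriv \<tau> \<rho> x = ennreal (D x)" "\<And>x. 0 \<le> D x"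
      using \<tau>.real_RN_deriv[OF \<rho>] by metis
    have "density \<tau> (\<lambda>x. ennreal (D x)) = density \<tau> (RN_deriv \<tau> \<rho>)"
      using D by (intro density_cong) auto
    also have "\<dots> = \<rho>" by (rule \<tau>.density_RN_deriv[OF \<rho>(2,3)])
    finally show ?thesis using D by blast
  qed
  obtain f where f[measurable]: "f \<in> borel_measurable \<tau>" and f0: "\<And>x. 0 \<le> f x"
    and \<mu>: "density \<tau> (\<lambda>x. ennreal (f x)) = \<mu>"
    using density[OF fin(1) \<tau>(3)] \<tau>(2) by auto
  obtain g where g[measurable]: "g \<in> borel_measurable \<tau>" and g0: "\<And>x. 0 \<le> g x"
    and \<nu>: "density \<tau> (\<lambda>x. ennreal (g x)) = \<nu>"
    using density[OF fin(2) \<tau>(4)] \<tau>(2) sets by auto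
  \<comment> \<open>\<open>\<mu> - \<nu>\<close> has the signed density \<open>f - g\<close>, so its Jordan parts have the densities \<open>(f - g)\<^sub>+\<close> and \<open>(g - f)\<^sub>+\<close>.\<close>
  define p where "p x = max (f x - g x) 0" for x
  define n where "n x = max (g x - f x) 0" for x
  have [measurable]: "p \<in> borel_measurable \<tau>" "n \<in> borel_measurable \<tau>"
    unfolding p_def n_def by measurable
  define \<mu>' where "\<mu>' = density \<tau> (\<lambda>x. ennreal (p x))"
  define \<nu>' where "\<nu>' = density \<tau> (\<lambda>x. ennreal (n x))"
  have finite': "finite_measure (density \<tau> (\<lambda>x. ennreal (h x)))"
    if [measurable]: "h \<in> borel_measurable \<tau>" "k \<in> borel_measurable \<tau>" and "\<And>x. h x \<le> k x"
      and k: "finite_measure (density \<tau> (\<lambda>x. ennreal (k x)))" for h k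
  proof
    have "emeasure (density \<tau> (\<lambda>x. ennreal (h x))) (space \<tau>)
        \<le> emeasure (density \<tau> (\<lambda>x. ennreal (k x))) (space \<tau>)"
      using that(3) by (simp add: emeasure_density nn_integral_mono ennreal_leI mult_right_mono)
    also have "\<dots> < \<infinity>"
      using finite_measure.emeasure_finite[OF k] by (simp add: less_top[symmetric])
    finally show "emeasure (density \<tau> (\<lambda>x. ennreal (h x))) (space (density \<tau> (\<lambda>x. ennreal (h x)))) \<noteq> \<infinity>"
      by simp
  qed
  have fin': "finite_measure \<mu>'" "finite_measure \<nu>'"
    unfolding \<mu>'_def \<nu>'_def
    using finite'[of p f] finite'[of n g] fin \<mu> \<nu> f0 g0 by (auto simp: p_def n_def)
  have sets': "sets \<mu>' = sets borel" "sets \<nu>' = sets borel"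
    using \<tau>(2) sets by (simp_all add: \<mu>'_def \<nu>'_def)
  have "(LINT x|\<mu>. \<phi> x) - (LINT x|\<nu>. \<phi> x) = (LINT x|\<mu>'. \<phi> x) - (LINT x|\<nu>'. \<phi> x)"
    if \<phi>: "smooth \<phi>" "compact (supp \<phi>)" for \<phi>
  proof -
    have [measurable]: "\<phi> \<in> borel_measurable \<tau>"
      using borel_measurable_continuous_onI[OF smooth_continuous_on[OF \<phi>(1)]]
        measurable_cong_sets[OF \<tau>(2)[unfolded sets(1)] refl] by blast
    have i: "integrable \<rho> \<phi>" if "finite_measure \<rho>" "sets \<rho> = sets borel" for \<rho> :: "real measure"
      using integrable_test_function that \<phi> by blast
    have I: "integrable \<tau> (\<lambda>x. f x *\<^sub>R \<phi> x)" "integrable \<tau> (\<lambda>x. g x *\<^sub>R \<phi> x)"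
      "integrable \<tau> (\<lambda>x. p x *\<^sub>R \<phi> x)" "integrable \<tau> (\<lambda>x. n x *\<^sub>R \<phi> x)"
      using i[OF fin(1) sets(1)] i[OF fin(2) sets(2)] i[OF fin'(1) sets'(1)] i[OF fin'(2) sets'(2)] f0 g0
      unfolding \<mu>[symmetric] \<nu>[symmetric] \<mu>'_def \<nu>'_def
      by (simp_all add: integrable_density p_def n_def)
    have "(LINT x|\<mu>. \<phi> x) - (LINT x|\<nu>. \<phi> x) = (LINT x|\<tau>. f x *\<^sub>R \<phi> x - g x *\<^sub>R \<phi> x)"
      unfolding \<mu>[symmetric] \<nu>[symmetric] using f0 g0 I by (simp add: integral_density)
    also have "\<dots> = (LINT x|\<tau>. p x *\<^sub>R \<phi> x - n x *\<^sub>R \<phi> x)"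
      by (rule Bochner_Integration.integral_cong) (auto simp: p_def n_def max_def algebra_simps)
    also have "\<dots> = (LINT x|\<mu>'. \<phi> x) - (LINT x|\<nu>'. \<phi> x)"
      unfolding \<mu>'_def \<nu>'_def using I by (subst (1 2) integral_density) (auto simp: p_def n_def)
    finally show ?thesis .
  qed
  then have "has_distr_deriv u \<mu>' \<nu>'"
    using fin' sets' int by (simp add: has_distr_deriv_def)
  moreover have "mutually_singular \<mu>' \<nu>'"
  proof -
    \<comment> \<open>The Hahn set: \<open>p\<close> vanishes off \<open>S\<close> and
      \<open>n\<close> vanishes on it.\<close>
    define S where "S = {x. g x < f x}"
    have space: "space \<tau> = UNIV" 
      using sets_eq_imp_space_eq[OF \<tau>(2)] sets_eq_imp_space_eq[OF sets(1)] by simp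
    have S: "S \<in> sets \<tau>"
      unfolding S_def using borel_measurable_less[OF g f] space by simp
    then have S': "- S \<in> sets \<tau>" using space by (metis Compl_eq_Diff_UNIV sets.compl_sets)
    have "emeasure \<mu>' (- S) = 0"
      unfolding \<mu>'_def using S' by (subst emeasure_density) (auto simp: S_def p_def indicator_def nn_integral_0_iff_AE)
    moreover have "emeasure \<nu>' S = 0"
      unfolding \<nu>'_def using S by (subst emeasure_density) (auto simp: S_def n_def indicator_def nn_integral_0_iff_AE)
    ultimately show ?thesis unfolding mutually_singular_def using S \<tau>(2) sets by auto
  qed
  ultimately show ?thesis using that by blast
qed

text \<open>Supplies the partner \<open>\<nu>\<close>, through which the falls of \<open>u\<close>
  enter the estimates.\<close>

lemma D_pos_distr_deriv:
  assumes "u \<in> BV"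
  obtains \<nu> where "has_distr_deriv u (D_pos u) \<nu>"
proof -
  obtain \<mu> \<nu> where "has_distr_deriv u \<mu> \<nu>" using assms by (auto simp: BV_def)
  then have "\<exists>\<mu> \<nu>. has_distr_deriv u \<mu> \<nu> \<and> mutually_singular \<mu> \<nu>"
    using Jordan_decomposition by metis
  then have "\<exists>\<nu>. has_distr_deriv u (D_pos u) \<nu> \<and> mutually_singular (D_pos u) \<nu>"
    unfolding D_pos_def by (rule someI_ex)
  then show ?thesis using that by blast
qed

section \<open>Recovering a BV function from its derivative measures\<close>

text \<open>A bounded kernel supported over a bounded range of \<open>s\<close> is integrable for
  the product of a finite measure with \<open>lborel\<close>. The outer integral is passed to the
  completion \<open>lebesgue\<close>, in which the densities are stated.\<close>

lemma Fubini_bounded: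
  fixes k :: "real \<Rightarrow> real \<Rightarrow> real"
  assumes fin: "finite_measure \<mu>" and sets: "sets \<mu> = sets borel"
    and meas: "(\<lambda>(x, s). k x s) \<in> borel_measurable (borel \<Otimes>\<^sub>M borel)"
    and bound: "\<And>x s. \<bar>k x s\<bar> \<le> B" and out: "\<And>x s. s \<notin> {y..z} \<Longrightarrow> k x s = 0"
  shows "integrable \<mu> (\<lambda>x. LINT s|lborel. k x s)"
    and "integrable lebesgue (\<lambda>s. LINT x|\<mu>. k x s)"
    and "(LINT x|\<mu>. LINT s|lborel. k x s) = (LINT s|lebesgue. LINT x|\<mu>. k x s)"
proof -
  interpret finite_measure \<mu> by fact
  interpret pair_sigma_finite \<mu> lborel ..
  have space: "space \<mu> = UNIV" using sets_eq_imp_space_eq[OF sets] by simp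
  have sets2: "sets (\<mu> \<Otimes>\<^sub>M lborel) = sets (borel \<Otimes>\<^sub>M borel)"
    using sets by (intro sets_pair_measure_cong) auto
  have int: "integrable (\<mu> \<Otimes>\<^sub>M lborel) (\<lambda>(x, s). k x s)"
  proof (rule integrableI_bounded_set)
    show "UNIV \<times> {y..z} \<in> sets (\<mu> \<Otimes>\<^sub>M lborel)" using sets by auto
    show "(\<lambda>(x, s). k x s) \<in> borel_measurable (\<mu> \<Otimes>\<^sub>M lborel)"
      using meas measurable_cong_sets[OF sets2 refl] by blast
    have "emeasure (\<mu> \<Otimes>\<^sub>M lborel) (UNIV \<times> {y..z}) = emeasure \<mu> UNIV * emeasure lborel {y..z}"
      using sets by (intro lborel.emeasure_pair_measure_Times) auto
    also have "\<dots> < \<infinity>"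
    proof -
      have "emeasure \<mu> UNIV < top"
        by (metis emeasure_finite infinity_ennreal_def top.not_eq_extremum)
      then show ?thesis by (simp add: ennreal_mult_less_top emeasure_lborel_Icc_eq)
    qed
    finally show "emeasure (\<mu> \<Otimes>\<^sub>M lborel) (UNIV \<times> {y..z}) < \<infinity>" .
    show "AE p in \<mu> \<Otimes>\<^sub>M lborel. p \<in> UNIV \<times> {y..z} \<longrightarrow> norm (case p of (x, s) \<Rightarrow> k x s) \<le> B"
      using bound by (intro AE_I2) auto
    show "AE p in \<mu> \<Otimes>\<^sub>M lborel. p \<notin> UNIV \<times> {y..z} \<longrightarrow> (case p of (x, s) \<Rightarrow> k x s) = 0"
      using out by (intro AE_I2) (auto simp del: atLeastAtMost_iff)
  qed
  show "integrable \<mu> (\<lambda>x. LINT s|lborel. k x s)"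
    using integrable_fst'[OF int] by simp
  have int_snd: "integrable lborel (\<lambda>s. LINT x|\<mu>. k x s)"
    using integrable_snd[OF int] by simp
  show "integrable lebesgue (\<lambda>s. LINT x|\<mu>. k x s)"
    using int_snd integrable_completion[OF borel_measurable_integrable[OF int_snd]] by simp
  show "(LINT x|\<mu>. LINT s|lborel. k x s) = (LINT s|lebesgue. LINT x|\<mu>. k x s)"
    using Fubini_integral[OF int] integral_completion[OF borel_measurable_integrable[OF int_snd]] by simp
qed

text \<open>For \<open>y \<le> z\<close> this is the length of
  \<open>[y, z] \<inter> [x, \<infinity>)\<close>. Its negative is an antiderivative of the
  indicator of \<open>[y, z]\<close>, up to the corners.\<close>

definition ramp :: "real \<Rightarrow> real \<Rightarrow> real \<Rightarrow> real" where
  "ramp y z x = max (z - x) 0 - max (y - x) 0"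

lemma integral_ramp:
  assumes fin: "finite_measure \<mu>" and sets: "sets \<mu> = sets borel" and yz: "y \<le> z"
  shows "set_integrable lebesgue {y..z} (\<lambda>s. measure \<mu> {..s})"
    and "(LINT x|\<mu>. ramp y z x) = (LINT s:{y..z}|lebesgue. measure \<mu> {..s})"
proof -
  define k where "k x s = indicator {y..z} s * (if x \<le> s then 1 else 0 :: real)" for x s :: real
  have "(\<lambda>(x, s). k x s) \<in> borel_measurable (borel \<Otimes>\<^sub>M borel)"
    unfolding k_def by measurable
  note F = Fubini_bounded[OF fin sets this, of 1 y z]
  have 1: "(LINT s|lborel. k x s) = ramp y z x" for x
  proof -
    have "(LINT s|lborel. k x s) = (LINT s|lborel. indicator {max x y..z} s)"
      by (intro Bochner_Integration.integral_cong) (auto simp: k_def indicator_def)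
    then show ?thesis using yz by (simp add: ramp_def max_def)
  qed
  have 2: "(LINT x|\<mu>. k x s) = indicator {y..z} s * measure \<mu> {..s}" for s
  proof -
    have "(LINT x|\<mu>. k x s) = (LINT x|\<mu>. indicator {y..z} s * indicator {..s} x)"
      by (intro Bochner_Integration.integral_cong) (auto simp: k_def indicator_def)
    then show ?thesis using sets_eq_imp_space_eq[OF sets] by simp
  qed
  have k: "\<And>x s. \<bar>k x s\<bar> \<le> 1" "\<And>x s. s \<notin> {y..z} \<Longrightarrow> k x s = 0"
    by (auto simp: k_def)
  show "set_integrable lebesgue {y..z} (\<lambda>s. measure \<mu> {..s})"
    using F(2)[OF k] by (simp add: 2 set_integrable_def)
  show "(LINT x|\<mu>. ramp y z x) = (LINT s:{y..z}|lebesgue. measure \<mu> {..s})"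
    using F(3)[OF k] by (simp add: 1 2 set_lebesgue_integral_def)
qed

text \<open>Formally, \<open>Du\<close> is tested with \<open>- ramp y z\<close>. That function has
  corners and a constant left tail, so it is reached as a bounded pointwise limit of genuine test
  functions.\<close>

lemma distr_deriv_interval:
  assumes D: "has_distr_deriv u \<mu> \<nu>" and iu: "integrable lebesgue u"
    and out: "AE r in lebesgue. r \<notin> {R1..R2} \<longrightarrow> u r = 0" and yz: "y \<le> z"
  shows "(LINT s:{y..z}|lebesgue. u s) = (LINT x|\<mu>. ramp y z x) - (LINT x|\<nu>. ramp y z x)"
proof -
  have fin: "finite_measure \<mu>" "finite_measure \<nu>" and sets: "sets \<mu> = sets borel" "sets \<nu> = sets borel"
    and parts: "\<And>\<phi>. smooth \<phi> \<Longrightarrow> compact (supp \<phi>) \<Longrightarrow>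
      (LINT x|lebesgue. u x * deriv \<phi> x) = - ((LINT x|\<mu>. \<phi> x) - (LINT x|\<nu>. \<phi> x))"
    using D by (auto simp: has_distr_deriv_def)
  obtain \<theta> :: "real \<Rightarrow> real" where \<theta>: "smooth \<theta>" "mono \<theta>"
    "\<And>x. x \<le> 0 \<Longrightarrow> \<theta> x = 0" "\<And>x. 1 \<le> x \<Longrightarrow> \<theta> x = 1" "\<And>x. deriv \<theta> x \<ge> 0"
    "\<And>x. x \<notin> {0<..<1} \<Longrightarrow> deriv \<theta> x = 0"
    and \<theta>01: "\<And>x. 0 \<le> \<theta> x" "\<And>x. \<theta> x \<le> 1"
    using smooth_step_exists by blast
  obtain \<Theta> where \<Theta>: "\<And>x. (\<Theta> has_real_derivative \<theta> x) (at x)" "\<And>x. x \<le> 0 \<Longrightarrow> \<Theta> x = 0"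
    by (rule antiderivative_vanishing_left[OF smooth_continuous_on[OF \<theta>(1)]]) (use \<theta>(3) in auto)
  have sm\<Theta>: "smooth \<Theta>" using smooth_if_DERIV[OF \<theta>(1) \<Theta>(1)] .
  have \<Theta>_mono: "\<Theta> s \<le> \<Theta> t" if "s \<le> t" for s t
    using DERIV_nonneg_imp_nondecreasing[OF that] \<Theta>(1) \<theta>01 by blast
  have \<Theta>_lip: "\<Theta> t - \<Theta> s \<le> t - s" if "s \<le> t" for s t
  proof -
    have "t - \<Theta> t \<ge> s - \<Theta> s"
    proof (rule DERIV_nonneg_imp_nondecreasing[OF that])
      fix x
      have "((\<lambda>x. x - \<Theta> x) has_real_derivative 1 - \<theta> x) (at x)"
        by (intro DERIV_diff DERIV_ident \<Theta>)
      then show "\<exists>d. ((\<lambda>x. x - \<Theta> x) has_real_derivative d) (at x) \<and> 0 \<le> d" using \<theta>01(2)[of x] by auto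
    qed
    then show ?thesis by simp
  qed
  have \<Theta>_right: "\<Theta> t = \<Theta> 1 + (t - 1)" if "1 \<le> t" for t
  proof -
    have "\<exists>c. \<forall>x\<in>{1..}. \<Theta> x - x = c"
    proof (rule has_field_derivative_zero_constant)
      fix x :: real assume "x \<in> {1..}"
      then show "((\<lambda>x. \<Theta> x - x) has_real_derivative 0) (at x within {1..})"
        using DERIV_diff[OF \<Theta>(1) DERIV_ident, of x] \<theta>(4)[of x]
        by (auto intro: has_field_derivative_at_within)
    qed simp
    then obtain c where "\<And>x. 1 \<le> x \<Longrightarrow> \<Theta> x - x = c" by auto
    from this[OF that] this[of 1] show ?thesis by simp
  qed
  \<comment> \<open>A uniform error for the positive part: after scaling,
    \<open>\<Theta> (m * t) / m\<close> is within \<open>1 / m\<close> of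
    \<open>max t 0\<close>.\<close>
  have \<Theta>_approx: "\<bar>\<Theta> t - max t 0\<bar> \<le> 1" for t
  proof -
    have 0: "\<Theta> 0 = 0" by (rule \<Theta>(2)) simp
    consider "t \<le> 0" | "0 \<le> t" "t \<le> 1" | "1 \<le> t" by linarith
    then show ?thesis
    proof cases
      case 1 then show ?thesis using \<Theta>(2)[of t] by simp
    next
      case 2 then show ?thesis using \<Theta>_mono[of 0 t] \<Theta>_lip[of 0 t] 0 by simp
    next
      case 3 then show ?thesis using \<Theta>_mono[of 0 1] \<Theta>_lip[of 0 1] \<Theta>_right[of t] 0 by simp
    qed
  qed
  \<comment> \<open>\<open>m n \<ge> 1 - R1\<close> puts the cutoff to the left of
    \<open>R1\<close>, where \<open>u\<close> vanishes; \<open>m n \<ge> 1\<close> makes both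
    \<open>\<Theta>\<close> terms affine once \<open>x\<close> is more than 1 to the left of
    \<open>y\<close>.\<close>
  define m where "m n = real n + max 1 (1 - R1)" for n
  have m: "1 \<le> m n" "1 - R1 \<le> m n" "0 < m n" for n by (auto simp: m_def)
  have m_lim: "filterlim m at_top sequentially"
    by (rule filterlim_at_top_mono[OF filterlim_real_sequentially]) (simp add: m_def)
  define L where "L n x = (\<Theta> (m n * (z - x)) - \<Theta> (m n * (y - x))) / m n" for n x
  \<comment> \<open>\<open>L n\<close> approximates the ramp, which equals \<open>z - y\<close> far to the left; the term with \<open>\<theta>\<close> cancels this
    constant beyond \<open>-m n\<close>, where \<open>u\<close> vanishes, and so makes \<open>\<phi> n\<close> compactly supported.\<close>
  define \<phi> where "\<phi> n x = (z - y) * (1 - \<theta> (x + m n)) - L n x" for n x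
  define \<phi>' where "\<phi>' n x = \<theta> (m n * (z - x)) - \<theta> (m n * (y - x)) - (z - y) * deriv \<theta> (x + m n)" for n x
  have deriv: "deriv (\<phi> n) = \<phi>' n" for n
  proof
    fix x
    have "((\<lambda>x. \<Theta> (m n * (c - x))) has_real_derivative \<theta> (m n * (c - x)) * (- m n)) (at x)" for c
      by (rule DERIV_chain2[OF \<Theta>(1)]) (auto intro!: derivative_eq_intros)
    then have "(L n has_real_derivative
        (\<theta> (m n * (z - x)) * (- m n) - \<theta> (m n * (y - x)) * (- m n)) / m n) (at x)"
      unfolding L_def by (intro DERIV_cdivide DERIV_diff)
    also have "(\<theta> (m n * (z - x)) * (- m n) - \<theta> (m n * (y - x)) * (- m n)) / m n
        = - (\<theta> (m n * (z - x)) - \<theta> (m n * (y - x)))"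
      using m[of n] by (simp add: field_simps)
    finally have L: "(L n has_real_derivative - (\<theta> (m n * (z - x)) - \<theta> (m n * (y - x)))) (at x)" .
    have "((\<lambda>x. \<theta> (x + m n)) has_real_derivative deriv \<theta> (x + m n) * 1) (at x)"
      by (rule DERIV_chain2[OF smooth_DERIV[OF \<theta>(1)]]) (auto intro!: derivative_eq_intros)
    then have "(\<phi> n has_real_derivative (z - y) * (0 - deriv \<theta> (x + m n) * 1)
        - - (\<theta> (m n * (z - x)) - \<theta> (m n * (y - x)))) (at x)"
      unfolding \<phi>_def by (intro DERIV_diff DERIV_cmult DERIV_const L)
    then show "deriv (\<phi> n) x = \<phi>' n x"
      using DERIV_imp_deriv by (force simp: \<phi>'_def)
  qed
  have smooth: "smooth (\<phi> n)" for n
  proof -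
    have arg: "m n * (c - x) = - m n * x + m n * c" for c x by (simp add: algebra_simps)
    have alg: "(z - y) * (1 - t) - (T1 - T2) / M
        = ((z - y) + (- (z - y)) * t) + ((- 1 / M) * T1 + (1 / M) * T2)" for t T1 T2 M :: real
      by (simp add: diff_divide_distrib algebra_simps)
    have eq: "\<phi> n = (\<lambda>x. ((z - y) + (- (z - y)) * \<theta> (1 * x + m n))
        + ((- 1 / m n) * \<Theta> (- m n * x + m n * z) + (1 / m n) * \<Theta> (- m n * x + m n * y)))"
      unfolding \<phi>_def L_def arg alg mult_1 ..
    show ?thesis unfolding eq
      by (intro smooth_add smooth_const smooth_affine[OF \<theta>(1)] smooth_affine[OF sm\<Theta>])
  qed
  have supp: "compact (supp (\<phi> n))" for n
  proof -
    have left: "\<phi> n x = 0" if "x < y - 1" "x < - m n" for x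
    proof -
      have "1 \<le> m n * t" if "1 \<le> t" for t
        using mult_mono[OF m(1)[of n] that] m(3)[of n] by simp
      then have ge: "1 \<le> m n * (y - x)" "1 \<le> m n * (z - x)"
        using that yz by auto
      have "L n x = (m n * (z - x) - m n * (y - x)) / m n"
        unfolding L_def \<Theta>_right[OF ge(1)] \<Theta>_right[OF ge(2)] by simp
      also have "\<dots> = z - y" using m(3)[of n] by (simp add: field_simps)
      finally show ?thesis using that \<theta>(3)[of "x + m n"] by (simp add: \<phi>_def)
    qed
    have right: "\<phi> n x = 0" if "z < x" "1 - m n < x" for x
    proof -
      have "m n * (y - x) \<le> 0" "m n * (z - x) \<le> 0"
        using m(3)[of n] that yz by (auto intro!: mult_nonneg_nonpos)
      then show ?thesis using that \<theta>(4)[of "x + m n"] by (simp add: \<phi>_def L_def \<Theta>(2))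
    qed
    have "{x. \<phi> n x \<noteq> 0} \<subseteq> {min (y - 1) (- m n)..max z (1 - m n)}"
    proof
      fix x assume x: "x \<in> {x. \<phi> n x \<noteq> 0}"
      then have "\<not> (x < y - 1 \<and> x < - m n)" "\<not> (z < x \<and> 1 - m n < x)"
        using left right by auto
      then show "x \<in> {min (y - 1) (- m n)..max z (1 - m n)}" by auto
    qed
    then have "bounded {x. \<phi> n x \<noteq> 0}" by (rule bounded_subset[rotated]) simp
    then show ?thesis by (simp add: supp_def)
  qed
  have \<phi>_lim: "(\<lambda>n. \<phi> n x) \<longlonglongrightarrow> - ramp y z x" for x
  proof -
    have "(\<lambda>n. L n x) \<longlonglongrightarrow> ramp y z x"
    proof (rule LIM_zero_cancel, rule Lim_null_comparison)
      show "\<forall>\<^sub>F n in sequentially. norm (L n x - ramp y z x) \<le> 2 * inverse (m n)"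
      proof (rule always_eventually, rule allI)
        fix n
        have "ramp y z x = (max (m n * (z - x)) 0 - max (m n * (y - x)) 0) / m n"
          using m(3)[of n] by (auto simp: ramp_def max_def field_simps mult_le_0_iff zero_le_mult_iff)
        then have "L n x - ramp y z x = ((\<Theta> (m n * (z - x)) - max (m n * (z - x)) 0)
            - (\<Theta> (m n * (y - x)) - max (m n * (y - x)) 0)) / m n"
          by (simp add: L_def diff_divide_distrib)
        moreover have "\<bar>(\<Theta> (m n * (z - x)) - max (m n * (z - x)) 0)
            - (\<Theta> (m n * (y - x)) - max (m n * (y - x)) 0)\<bar> \<le> 2"
          using \<Theta>_approx[of "m n * (z - x)"] \<Theta>_approx[of "m n * (y - x)"] by linarith
        ultimately show "norm (L n x - ramp y z x) \<le> 2 * inverse (m n)"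
          using m(3)[of n] by (simp add: abs_divide divide_right_mono flip: divide_inverse)
      qed
      show "(\<lambda>n. 2 * inverse (m n)) \<longlonglongrightarrow> 0"
        using tendsto_mult_right_zero[OF tendsto_inverse_0_at_top[OF m_lim]] .
    qed
    moreover have "(\<lambda>n. (z - y) * (1 - \<theta> (x + m n))) \<longlonglongrightarrow> 0"
    proof (rule tendsto_eventually)
      show "\<forall>\<^sub>F n in sequentially. (z - y) * (1 - \<theta> (x + m n)) = 0"
        using filterlim_at_top[THEN iffD1, OF m_lim, rule_format, of "1 - x"]
        by eventually_elim (simp add: \<theta>(4))
    qed
    ultimately show ?thesis unfolding \<phi>_def using tendsto_diff by fastforce
  qed
  \<comment> \<open>Since \<open>\<Theta>\<close> is monotone and 1-Lipschitz, \<open>L n\<close>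
    lies between 0 and \<open>z - y\<close>. This is the dominating constant for finite
    measures.\<close>
  have \<phi>_bound: "\<bar>\<phi> n x\<bar> \<le> 2 * (z - y)" for n x
  proof -
    have "m n * (y - x) \<le> m n * (z - x)" using m(3)[of n] yz by simp
    then have "0 \<le> L n x" "L n x \<le> (m n * (z - x) - m n * (y - x)) / m n"
      unfolding L_def using \<Theta>_mono \<Theta>_lip m(3)[of n]
      by (auto intro!: divide_right_mono divide_nonneg_pos)
    moreover have "(m n * (z - x) - m n * (y - x)) / m n = z - y"
      using m(3)[of n] by (simp add: field_simps)
    moreover have "0 \<le> (z - y) * (1 - \<theta> (x + m n))" "(z - y) * (1 - \<theta> (x + m n)) \<le> z - y"
      using yz \<theta>01[of "x + m n"] by (auto intro: mult_left_le)
    ultimately show ?thesis by (simp add: \<phi>_def)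
  qed
  have rhs: "(\<lambda>n. LINT x|\<rho>. \<phi> n x) \<longlonglongrightarrow> (LINT x|\<rho>. - ramp y z x)"
    if \<rho>: "finite_measure \<rho>" "sets \<rho> = sets borel" for \<rho> :: "real measure"
  proof (rule integral_dominated_convergence)
    have "(\<lambda>x. - ramp y z x) \<in> borel_measurable borel" unfolding ramp_def by measurable
    then show "(\<lambda>x. - ramp y z x) \<in> borel_measurable \<rho>"
      using measurable_cong_sets[OF \<rho>(2) refl] by blast
    show "\<phi> n \<in> borel_measurable \<rho>" for n
      using borel_measurable_continuous_onI[OF smooth_continuous_on[OF smooth]]
        measurable_cong_sets[OF \<rho>(2) refl] by blast
    show "integrable \<rho> (\<lambda>x. 2 * (z - y))"
      using \<rho>(1) by (intro finite_measure.integrable_const)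
    show "AE x in \<rho>. (\<lambda>n. \<phi> n x) \<longlonglongrightarrow> - ramp y z x" using \<phi>_lim by simp
    show "AE x in \<rho>. norm (\<phi> n x) \<le> 2 * (z - y)" for n using \<phi>_bound by simp
  qed
  have lhs: "(\<lambda>n. LINT x|lebesgue. u x * \<phi>' n x) \<longlonglongrightarrow> (LINT x|lebesgue. indicator {y..z} x *\<^sub>R u x)"
  proof (rule integral_dominated_convergence)
    have u_meas: "u \<in> borel_measurable lebesgue" using iu by (rule borel_measurable_integrable)
    show "(\<lambda>x. indicat_real {y..z} x *\<^sub>R u x) \<in> borel_measurable lebesgue"
      by (intro borel_measurable_integrable integrable_mult_indicator iu) simp
    have "\<phi>' n \<in> borel_measurable borel" for n
      using borel_measurable_continuous_onI[OF smooth_continuous_on[OF smooth_deriv[OF smooth]]]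
      unfolding deriv .
    then have "\<phi>' n \<in> borel_measurable lebesgue" for n
      by (intro measurable_completion) simp
    then show "(\<lambda>x. u x * \<phi>' n x) \<in> borel_measurable lebesgue" for n
      using u_meas by (intro borel_measurable_times)
    show "integrable lebesgue (\<lambda>x. norm (u x))" using iu by simp
    have eq: "\<phi>' n x = \<theta> (m n * (z - x)) - \<theta> (m n * (y - x))" if "x \<in> {R1..R2}" for n x
      using that m(2)[of n] by (simp add: \<phi>'_def \<theta>(6))
    have step_lim: "(\<lambda>n. \<theta> (m n * t)) \<longlonglongrightarrow> (if 0 < t then 1 else 0)" for t
    proof (rule tendsto_eventually)
      show "\<forall>\<^sub>F n in sequentially. \<theta> (m n * t) = (if 0 < t then 1 else 0)"
        using filterlim_at_top[THEN iffD1, OF m_lim, rule_format, of "1 / t"]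
      proof eventually_elim
        case (elim n)
        show ?case
        proof (cases "0 < t")
          case True then show ?thesis using elim \<theta>(4)[of "m n * t"] by (simp add: divide_le_eq)
        next
          case False then show ?thesis using m(3)[of n] \<theta>(3)[of "m n * t"] by (simp add: mult_le_0_iff)
        qed
      qed
    qed
    \<comment> \<open>At \<open>x = z\<close> the limit is 0, whereas the indicator of the closed
      interval is 1.\<close>
    have neq: "AE x in lebesgue. x \<noteq> z"
      by (rule AE_completion) (rule AE_lborel_singleton)
    show "AE x in lebesgue. (\<lambda>n. u x * \<phi>' n x) \<longlonglongrightarrow> indicat_real {y..z} x *\<^sub>R u x"
      using out neq
    proof eventually_elim
      case (elim x)
      show ?case
      proof (cases "x \<in> {R1..R2}")
        case True
        have "(\<lambda>n. u x * \<phi>' n x) \<longlonglongrightarrow> u x * ((if 0 < z - x then 1 else 0) - (if 0 < y - x then 1 else 0))"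
          unfolding eq[OF True] by (intro tendsto_intros step_lim)
        then show ?thesis using elim(2) yz by (auto simp: indicator_def split: if_splits)
      next
        case False
        then show ?thesis using elim by simp
      qed
    qed
    show "AE x in lebesgue. norm (u x * \<phi>' n x) \<le> norm (u x)" for n
      using out
    proof eventually_elim
      case (elim x)
      show ?case
      proof (cases "x \<in> {R1..R2}")
        case True
        have "\<bar>\<phi>' n x\<bar> \<le> 1" unfolding eq[OF True]
          using \<theta>01[of "m n * (z - x)"] \<theta>01[of "m n * (y - x)"] by linarith
        then show ?thesis by (simp add: abs_mult mult_left_le)
      next
        case False
        then show ?thesis using elim by simp
      qed
    qed
  qed
  have "(\<lambda>n. LINT x|lebesgue. u x * \<phi>' n x) \<longlonglongrightarrow>
      - ((LINT x|\<mu>. - ramp y z x) - (LINT x|\<nu>. - ramp y z x))"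
    unfolding deriv[symmetric] parts[OF smooth supp]
    by (intro tendsto_intros rhs fin sets)
  then show ?thesis
    using LIMSEQ_unique[OF lhs] by (simp add: set_lebesgue_integral_def)
qed

text \<open>Lebesgue differentiation: outside a negligible set, \<open>w x\<close> is the limit of
  the averages of \<open>w\<close> over \<open>[x, x + h]\<close>, all of which vanish.\<close>

lemma AE_zero_if_interval_integrals_zero:
  fixes w :: "real \<Rightarrow> real"
  assumes int: "\<And>y z. set_integrable lebesgue {y..z} w"
    and zero: "\<And>y z. y \<le> z \<Longrightarrow> (LINT s:{y..z}|lebesgue. w s) = 0"
  shows "AE s in lebesgue. w s = 0"
proof -
  have I: "w integrable_on {y..z}" "integral {y..z} w = (LINT s:{y..z}|lebesgue. w s)" for y z
    using set_lebesgue_integral_eq_integral[OF int] by auto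
  obtain N where N: "negligible N" and lim: "\<And>x e. \<lbrakk>x \<notin> N; 0 < e\<rbrakk> \<Longrightarrow>
      \<exists>d>0. \<forall>h. 0 < h \<and> h < d \<longrightarrow>
        norm (integral (cbox x (x + h *\<^sub>R One)) w /\<^sub>R h ^ DIM(real) - w x) < e"
    using integrable_ccontinuous_explicit[of w] I(1) by (metis box_real(2))
  have "w x = 0" if x: "x \<notin> N" for x
  proof (rule ccontr)
    assume "w x \<noteq> 0"
    then obtain d where d: "d > 0" "\<And>h. 0 < h \<and> h < d \<Longrightarrow>
        norm (integral (cbox x (x + h *\<^sub>R One)) w /\<^sub>R h ^ DIM(real) - w x) < \<bar>w x\<bar>"
      using lim[OF x, of "\<bar>w x\<bar>"] by auto
    have "integral (cbox x (x + (d / 2) *\<^sub>R One)) w = 0"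
      using I(2)[of x "x + d / 2"] zero[of x "x + d / 2"] d(1) by simp
    then show False using d(2)[of "d / 2"] d(1) by simp
  qed
  then show ?thesis
    using N by (auto simp: negligible_iff_null_sets eventually_ae_filter)
qed

text \<open>Both sides have the same integral over every interval, namely the difference of the two
  ramp integrals.\<close>

lemma distr_deriv_cdf:
  assumes D: "has_distr_deriv u \<mu> \<nu>" and iu: "integrable lebesgue u"
    and out: "AE r in lebesgue. r \<notin> {R1..R2} \<longrightarrow> u r = 0"
  shows "AE s in lebesgue. u s = measure \<mu> {..s} - measure \<nu> {..s}"
proof -
  have fin: "finite_measure \<mu>" "finite_measure \<nu>" and sets: "sets \<mu> = sets borel" "sets \<nu> = sets borel"
    using D by (auto simp: has_distr_deriv_def)
  define G where "G \<rho> s = measure \<rho> {..s}" for \<rho> :: "real measure" and s :: real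
  have iG: "set_integrable lebesgue {y..z} (G \<rho>)"
    if \<rho>: "finite_measure \<rho>" "sets \<rho> = sets borel" for \<rho> y z
  proof (cases "y \<le> z")
    case True
    then show ?thesis using integral_ramp(1)[OF \<rho>] by (simp add: G_def[abs_def])
  qed (simp add: set_integrable_def)
  have iu': "set_integrable lebesgue {y..z} u" for y z
    using iu unfolding set_integrable_def by (intro integrable_mult_indicator) auto
  have "AE s in lebesgue. u s - (G \<mu> s - G \<nu> s) = 0"
  proof (rule AE_zero_if_interval_integrals_zero)
    show "set_integrable lebesgue {y..z} (\<lambda>s. u s - (G \<mu> s - G \<nu> s))" for y z
      by (intro set_integral_diff iu' iG fin sets)
    fix y z :: real assume yz: "y \<le> z"
    have ramp: "(LINT x|\<rho>. ramp y z x) = (LINT s:{y..z}|lebesgue. G \<rho> s)"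
      if "finite_measure \<rho>" "sets \<rho> = sets borel" for \<rho>
      using integral_ramp(2)[OF that yz] by (simp add: G_def)
    show "(LINT s:{y..z}|lebesgue. u s - (G \<mu> s - G \<nu> s)) = 0"
      using distr_deriv_interval[OF D iu out yz]
      by (simp add: set_integral_diff iu' iG fin sets ramp)
  qed
  then show ?thesis by (simp add: G_def)
qed

text \<open>Strictness of the approach decides the fate of an atom at \<open>c\<close>: it is lost
  from the left and kept from the right.\<close>

lemma tendsto_measure_atMost:
  assumes fin: "finite_measure \<mu>" and sets: "sets \<mu> = sets borel" and lim: "s \<longlonglongrightarrow> (c::real)"
  shows "(\<And>n. s n < c) \<Longrightarrow> (\<lambda>n. measure \<mu> {..s n}) \<longlonglongrightarrow> measure \<mu> {..<c}"
    and "(\<And>n. c < s n) \<Longrightarrow> (\<lambda>n. measure \<mu> {..s n}) \<longlonglongrightarrow> measure \<mu> {..c}"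
proof -
  interpret finite_measure \<mu> by fact
  have sp: "space \<mu> = UNIV" using sets_eq_imp_space_eq[OF sets] by simp
  have dct: "(\<lambda>n. measure \<mu> (S n)) \<longlonglongrightarrow> measure \<mu> T"
    if S: "\<And>n. S n \<in> sets borel" "T \<in> sets borel"
      and "\<And>x. (\<lambda>n. indicat_real (S n) x) \<longlonglongrightarrow> indicat_real T x" for S :: "nat \<Rightarrow> real set" and T
  proof -
    have "(\<lambda>n. LINT x|\<mu>. indicat_real (S n) x) \<longlonglongrightarrow> (LINT x|\<mu>. indicat_real T x)"
      by (rule integral_dominated_convergence[where w = "\<lambda>_. 1"])
        (use that sets in \<open>auto simp: indicator_def\<close>)
    then show ?thesis using S sets sp by simp
  qed
  show "(\<lambda>n. measure \<mu> {..s n}) \<longlonglongrightarrow> measure \<mu> {..<c}" if less: "\<And>n. s n < c"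
  proof (rule dct)
    fix x
    show "(\<lambda>n. indicat_real {..s n} x) \<longlonglongrightarrow> indicat_real {..<c} x"
    proof (rule tendsto_eventually, cases "x < c")
      case True
      show "\<forall>\<^sub>F n in sequentially. indicat_real {..s n} x = indicat_real {..<c} x"
        using order_tendstoD(1)[OF lim True] by eventually_elim (use True in \<open>simp add: indicator_def\<close>)
    next
      case False
      then have "\<not> x \<le> s n" for n using less[of n] by linarith
      then show "\<forall>\<^sub>F n in sequentially. indicat_real {..s n} x = indicat_real {..<c} x"
        using False by (simp add: indicator_def)
    qed
  qed auto
  show "(\<lambda>n. measure \<mu> {..s n}) \<longlonglongrightarrow> measure \<mu> {..c}" if greater: "\<And>n. c < s n"
  proof (rule dct)
    fix x
    show "(\<lambda>n. indicat_real {..s n} x) \<longlonglongrightarrow> indicat_real {..c} x"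
    proof (rule tendsto_eventually, cases "x \<le> c")
      case True
      then have "x \<le> s n" for n using greater[of n] by linarith
      then show "\<forall>\<^sub>F n in sequentially. indicat_real {..s n} x = indicat_real {..c} x"
        using True by (simp add: indicator_def)
    next
      case False
      then show "\<forall>\<^sub>F n in sequentially. indicat_real {..s n} x = indicat_real {..c} x"
        using order_tendstoD(2)[OF lim, of x] by (auto elim!: eventually_mono simp: indicator_def)
    qed
  qed auto
qed

lemma AE_lebesgue_dense:
  assumes "AE s in lebesgue. Q (s::real)" "y < z"
  obtains s where "y < s" "s < z" "Q s"
proof (rule ccontr)
  assume "\<not> thesis"
  then have no: "\<And>s. y < s \<Longrightarrow> s < z \<Longrightarrow> \<not> Q s" using that by blast
  have "AE s in lebesgue. s \<notin> {y<..<z}"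
    using assms(1) by eventually_elim (use no in auto)
  then have "{y<..<z} \<in> null_sets lebesgue"
    by (subst (asm) AE_iff_null_sets[symmetric]) auto
  then show False using assms(2) by (simp add: null_sets_def)
qed

text \<open>Where \<open>u\<close> vanishes almost everywhere, the two distribution functions agree
  almost everywhere. Approaching \<open>R1\<close> from the left shows that the measures have equal
  mass on \<open>{..<R1}\<close>, and approaching \<open>R2\<close> from the right that they have
  equal mass on \<open>{..R2}\<close>; endpoint atoms remain inside \<open>[R1, R2]\<close>.\<close>

lemma distr_deriv_restrict:
  assumes D: "has_distr_deriv u \<mu> \<nu>" and iu: "integrable lebesgue u"
    and out: "AE r in lebesgue. r \<notin> {R1..R2} \<longrightarrow> u r = 0" and R: "R1 \<le> R2"
  shows "AE s in lebesgue. s \<in> {R1..R2} \<longrightarrow> u s = measure \<mu> {R1..s} - measure \<nu> {R1..s}"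
    and "measure \<mu> {R1..R2} = measure \<nu> {R1..R2}"
proof -
  have fin: "finite_measure \<mu>" "finite_measure \<nu>" and sets: "sets \<mu> = sets borel" "sets \<nu> = sets borel"
    using D by (auto simp: has_distr_deriv_def)
  note cdf = distr_deriv_cdf[OF D iu out]
  have eq: "AE s in lebesgue. s \<notin> {R1..R2} \<longrightarrow> measure \<mu> {..s} = measure \<nu> {..s}"
    using cdf out by eventually_elim auto
  have "\<exists>s. R1 - inverse (real (Suc n)) < s \<and> s < R1 \<and> measure \<mu> {..s} = measure \<nu> {..s}" for n
    using AE_lebesgue_dense[OF eq, of "R1 - inverse (real (Suc n))" R1] by force
  then obtain s where s: "\<And>n. R1 - inverse (real (Suc n)) < s n" "\<And>n. s n < R1"
    "\<And>n. measure \<mu> {..s n} = measure \<nu> {..s n}" by metis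
  have "s \<longlonglongrightarrow> R1"
  proof (rule tendsto_sandwich)
    show "(\<lambda>n. R1 - inverse (real (Suc n))) \<longlonglongrightarrow> R1"
      using tendsto_diff[OF tendsto_const LIMSEQ_inverse_real_of_nat, of R1] by simp
  qed (use s in \<open>auto intro!: always_eventually less_imp_le\<close>)
  note lim = tendsto_measure_atMost(1)[OF _ _ this s(2)]
  have left: "measure \<mu> {..<R1} = measure \<nu> {..<R1}"
    by (rule LIMSEQ_unique[OF lim[OF fin(1) sets(1)]]) (unfold s(3), rule lim[OF fin(2) sets(2)])
  have "\<exists>s. R2 < s \<and> s < R2 + inverse (real (Suc n)) \<and> measure \<mu> {..s} = measure \<nu> {..s}" for n
    using AE_lebesgue_dense[OF eq, of R2 "R2 + inverse (real (Suc n))"] by force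
  then obtain t where t: "\<And>n. t n < R2 + inverse (real (Suc n))" "\<And>n. R2 < t n"
    "\<And>n. measure \<mu> {..t n} = measure \<nu> {..t n}" by metis
  have "t \<longlonglongrightarrow> R2"
  proof (rule tendsto_sandwich[where f = "\<lambda>_. R2"])
    show "(\<lambda>n. R2 + inverse (real (Suc n))) \<longlonglongrightarrow> R2"
      using tendsto_add[OF tendsto_const LIMSEQ_inverse_real_of_nat, of R2] by simp
  qed (use t in \<open>auto intro!: always_eventually less_imp_le\<close>)
  note lim = tendsto_measure_atMost(2)[OF _ _ this t(2)]
  have right: "measure \<mu> {..R2} = measure \<nu> {..R2}"
    by (rule LIMSEQ_unique[OF lim[OF fin(1) sets(1)]]) (unfold t(3), rule lim[OF fin(2) sets(2)])
  have split: "measure \<rho> {..s} = measure \<rho> {..<R1} + measure \<rho> {R1..s}"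
    if "finite_measure \<rho>" "sets \<rho> = sets borel" "R1 \<le> s" for \<rho> :: "real measure" and s
  proof -
    have "{..s} = {..<R1} \<union> {R1..s}" using that by auto
    moreover have "{..<R1} \<inter> {R1..s} = {}" by auto
    ultimately show ?thesis using finite_measure.finite_measure_Union[OF that(1), of "{..<R1}" "{R1..s}"] that(2) by simp
  qed
  show "measure \<mu> {R1..R2} = measure \<nu> {R1..R2}"
    using right left split[OF fin(1) sets(1) R] split[OF fin(2) sets(2) R] by simp
  show "AE s in lebesgue. s \<in> {R1..R2} \<longrightarrow> u s = measure \<mu> {R1..s} - measure \<nu> {R1..s}"
    using cdf by eventually_elim
      (use left split[OF fin(1) sets(1)] split[OF fin(2) sets(2)] in auto)
qed

section \<open>Stability\<close>

lemma set_integrable_continuous: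
  fixes f :: "real \<Rightarrow> real"
  assumes "finite_measure \<mu>" "sets \<mu> = sets borel" "continuous_on {y..z} f"
  shows "set_integrable \<mu> {y..z} f"
proof -
  have "compact (f ` {y..z})" using assms(3) by (intro compact_continuous_image) auto
  then obtain B where B: "\<And>x. x \<in> {y..z} \<Longrightarrow> \<bar>f x\<bar> \<le> B"
    using compact_imp_bounded bounded_real by (metis imageI)
  show ?thesis unfolding set_integrable_def
  proof (rule integrable_bounded_borel[OF assms(1,2)])
    show "(\<lambda>x. indicat_real {y..z} x *\<^sub>R f x) \<in> borel_measurable borel"
      using assms(3) by (intro borel_measurable_continuous_on_indicator) auto
    show "\<bar>indicat_real {y..z} x *\<^sub>R f x\<bar> \<le> \<bar>B\<bar>" for x
      using B[of x] by (auto simp: indicator_def)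
  qed
qed

text \<open>Fubini on the triangle y \<le> x \<le> s \<le> z. The inner integral is
  \<open>z - x\<close> for \<open>g = 1\<close> and \<open>A_fun z x\<close> for
  \<open>g s = s\<^sup>2\<close>, the two cases used below.\<close>

lemma integral_measure_atLeastAtMost:
  fixes g :: "real \<Rightarrow> real"
  assumes fin: "finite_measure \<mu>" and sets: "sets \<mu> = sets borel"
    and g[measurable]: "g \<in> borel_measurable borel" and bound: "\<And>s. s \<in> {y..z} \<Longrightarrow> \<bar>g s\<bar> \<le> B"
  shows "set_integrable \<mu> {y..z} (\<lambda>x. LINT s:{x..z}|lborel. g s)"
    and "set_integrable lebesgue {y..z} (\<lambda>s. g s * measure \<mu> {y..s})"
    and "(LINT x:{y..z}|\<mu>. LINT s:{x..z}|lborel. g s) = (LINT s:{y..z}|lebesgue. g s * measure \<mu> {y..s})"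
proof -
  define k where "k x s = (if y \<le> x \<and> x \<le> s \<and> s \<le> z then g s else 0)" for x s
  have "(\<lambda>(x, s). k x s) \<in> borel_measurable (borel \<Otimes>\<^sub>M borel)"
    unfolding k_def by measurable
  note F = Fubini_bounded[OF fin sets this, of "\<bar>B\<bar>" y z]
  have 1: "(LINT s|lborel. k x s) = indicat_real {y..z} x *\<^sub>R (LINT s:{x..z}|lborel. g s)" for x
  proof (cases "x \<in> {y..z}")
    case True
    then show ?thesis unfolding set_lebesgue_integral_def
      by (auto intro!: Bochner_Integration.integral_cong simp: k_def indicator_def)
  next
    case False
    then have "k x s = 0" for s by (auto simp: k_def)
    then show ?thesis using False by simp
  qed
  have 2: "(LINT x|\<mu>. k x s) = indicat_real {y..z} s *\<^sub>R (g s * measure \<mu> {y..s})" for s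
  proof -
    have "(LINT x|\<mu>. k x s) = (LINT x|\<mu>. (indicat_real {y..z} s * g s) * indicator {y..s} x)"
      by (intro Bochner_Integration.integral_cong) (auto simp: k_def indicator_def)
    then show ?thesis using sets_eq_imp_space_eq[OF sets] by simp
  qed
  have k: "\<And>x s. \<bar>k x s\<bar> \<le> \<bar>B\<bar>" "\<And>x s. s \<notin> {y..z} \<Longrightarrow> k x s = 0"
    unfolding k_def using bound by (auto intro: order_trans[OF _ abs_ge_self])
  show "set_integrable \<mu> {y..z} (\<lambda>x. LINT s:{x..z}|lborel. g s)"
    using F(1)[OF k] by (simp only: 1 set_integrable_def simp_thms)
  show "set_integrable lebesgue {y..z} (\<lambda>s. g s * measure \<mu> {y..s})"
    using F(2)[OF k] by (simp only: 2 set_integrable_def simp_thms)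
  show "(LINT x:{y..z}|\<mu>. LINT s:{x..z}|lborel. g s) = (LINT s:{y..z}|lebesgue. g s * measure \<mu> {y..s})"
    using F(3)[OF k] by (simp only: 1 2 set_lebesgue_integral_def simp_thms)
qed

text \<open>Moving all of \<open>\<mu>\<close> on \<open>[y, z]\<close> to the point
  \<open>b\<close> costs the integral of \<open>\<bar>x - b\<bar>\<close>. This transport cost
  bounds the L1 distance of the distribution functions; \<open>K\<close> is the integrable majorant
  that realises the bound.\<close>

lemma integral_cdf_deviation:
  assumes fin: "finite_measure \<mu>" and sets: "sets \<mu> = sets borel" and b: "y \<le> b" "b \<le> z"
  obtains K where "set_integrable lebesgue {y..z} K"
    "(LINT s:{y..z}|lebesgue. K s) = (LINT x:{y..z}|\<mu>. \<bar>x - b\<bar>)"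
    "\<And>s. s \<in> {y..z} \<Longrightarrow> \<bar>measure \<mu> {y..s} - measure \<mu> {y..z} * indicator {b<..} s\<bar> \<le> K s"
proof -
  define j where "j x s = (if y \<le> x \<and> x \<le> z \<and> y \<le> s \<and> s \<le> z
      then (if x \<le> s then 1 else 0) - (if b < s then 1 else 0) else 0 :: real)" for x s
  have j_meas[measurable]: "(\<lambda>(x, s). j x s) \<in> borel_measurable (borel \<Otimes>\<^sub>M borel)"
    unfolding j_def by measurable
  have "(\<lambda>(x, s). \<bar>j x s\<bar>) \<in> borel_measurable (borel \<Otimes>\<^sub>M borel)" by measurable
  note F = Fubini_bounded[OF fin sets this, of 1 y z]
  have j_bd: "\<And>x s. \<bar>\<bar>j x s\<bar>\<bar> \<le> 1" "\<And>x s. s \<notin> {y..z} \<Longrightarrow> \<bar>j x s\<bar> = 0"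
    by (auto simp: j_def)
  \<comment> \<open>The deviation at \<open>s\<close> is \<open>\<integral> j x s d\<mu>(x)\<close>; with absolute values inside, Fubini evaluates the integral over \<open>s\<close>.\<close>
  define K where "K s = (LINT x|\<mu>. \<bar>j x s\<bar>)" for s
  have K: "K s = indicat_real {y..z} s *\<^sub>R K s" for s
    by (cases "s \<in> {y..z}") (auto simp: K_def j_def)
  have 1: "(LINT s|lborel. \<bar>j x s\<bar>) = indicat_real {y..z} x *\<^sub>R \<bar>x - b\<bar>" for x
  proof (cases "x \<in> {y..z}")
    case True
    show ?thesis
    proof (cases "x \<le> b")
      case le: True
      have "(LINT s|lborel. \<bar>j x s\<bar>) = (LINT s|lborel. indicator {x..b} s)"
        using True le b by (intro Bochner_Integration.integral_cong) (auto simp: j_def indicator_def)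
      then show ?thesis using True le by simp
    next
      case False
      have "(LINT s|lborel. \<bar>j x s\<bar>) = (LINT s|lborel. indicator {b<..<x} s)"
        using True False b by (intro Bochner_Integration.integral_cong) (auto simp: j_def indicator_def)
      then show ?thesis using True False by simp
    qed
  next
    case False
    then have "j x s = 0" for s by (auto simp: j_def)
    then show ?thesis using False by simp
  qed
  show ?thesis
  proof
    show "set_integrable lebesgue {y..z} K"
      unfolding set_integrable_def K[symmetric] using F(2)[OF j_bd] by (simp add: K_def[abs_def])
    show "(LINT s:{y..z}|lebesgue. K s) = (LINT x:{y..z}|\<mu>. \<bar>x - b\<bar>)"
      unfolding set_lebesgue_integral_def K[symmetric] using F(3)[OF j_bd] by (simp add: 1 K_def)
    fix s assume s: "s \<in> {y..z}"
    have ind: "integrable \<mu> (\<lambda>x. c * indicat_real {y..t} x)" for c t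
    proof (rule integrable_bounded_borel[OF fin sets, of _ "\<bar>c\<bar>"])
      show "\<bar>c * indicat_real {y..t} x\<bar> \<le> \<bar>c\<bar>" for x by (auto simp: indicator_def)
    qed measurable
    have "j x s = indicat_real {y..s} x - indicator {b<..} s * indicat_real {y..z} x" for x
      using s by (auto simp: j_def indicator_def)
    then have "(LINT x|\<mu>. j x s) = (LINT x|\<mu>. 1 * indicat_real {y..s} x - indicator {b<..} s * indicat_real {y..z} x)"
      by simp
    also have "\<dots> = (LINT x|\<mu>. 1 * indicat_real {y..s} x) - (LINT x|\<mu>. indicator {b<..} s * indicat_real {y..z} x)"
      by (rule Bochner_Integration.integral_diff[OF ind ind])
    also have "\<dots> = measure \<mu> {y..s} - measure \<mu> {y..z} * indicator {b<..} s"
      using sets_eq_imp_space_eq[OF sets] by simp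
    finally have "measure \<mu> {y..s} - measure \<mu> {y..z} * indicator {b<..} s = (LINT x|\<mu>. j x s)" ..
    then show "\<bar>measure \<mu> {y..s} - measure \<mu> {y..z} * indicator {b<..} s\<bar> \<le> K s"
      unfolding K_def by (simp add: integral_abs_bound)
  qed
qed

lemma integral_square_interval:
  fixes x y :: real
  assumes "x \<le> y"
  shows "(LINT s:{x..y}|lborel. s\<^sup>2) = A_fun y x"
proof -
  have "(LINT s|lborel. s\<^sup>2 * indicator {x..y} s) = y^3 / 3 - x^3 / 3"
    by (rule integral_FTC_Icc_real[OF assms]) (auto intro!: derivative_eq_intros)
  then show ?thesis by (simp add: set_lebesgue_integral_def A_fun_def mult.commute diff_divide_distrib)
qed

text \<open>Comes from the factor R^2 + R x + x^2 \<ge> R^2 of R^3 - x^3. It converts the penalty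
  \<open>l \<integral> A d(Du)^-\<close> into control of the moment of the falls about
  \<open>R2\<close>.\<close>

lemma A_fun_ge_linear:
  assumes "0 \<le> x" "x \<le> R"
  shows "R\<^sup>2 / 3 * (R - x) \<le> A_fun R x"
proof -
  have "A_fun R x = (R\<^sup>2 + R * x + x\<^sup>2) / 3 * (R - x)"
    by (simp add: A_fun_def power2_eq_square power3_eq_cube algebra_simps)
  then show ?thesis using assms by (auto intro!: mult_right_mono divide_right_mono)
qed

section \<open>Deficit estimates for BV densities\<close>

context shell begin

lemma A_BV_shell_density:
  assumes u: "u \<in> A_BV R1 R2"
  shows "shell_density M1 M2 R1 R2 u"
proof
  have iu: "integrable lebesgue u" using u by (simp add: A_BV_def BV_def)
  show "set_integrable lebesgue {R1..R2} (\<lambda>r. r^2 * u r)"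
    unfolding set_integrable_def
  proof (rule Bochner_Integration.integrable_bound)
    show "integrable lebesgue (\<lambda>r. R2\<^sup>2 * u r)" using iu by simp
    have "(\<lambda>r::real. indicat_real {R1..R2} r * r\<^sup>2) \<in> borel_measurable lebesgue"
      by (intro measurable_completion) simp
    from borel_measurable_times[OF this borel_measurable_integrable[OF iu]]
    show "(\<lambda>r. indicat_real {R1..R2} r *\<^sub>R (r\<^sup>2 * u r)) \<in> borel_measurable lebesgue"
      by (simp add: mult.assoc)
    show "AE r in lebesgue. norm (indicat_real {R1..R2} r *\<^sub>R (r\<^sup>2 * u r)) \<le> norm (R2\<^sup>2 * u r)"
      using R1_pos by (intro AE_I2) (auto simp: indicator_def abs_mult intro!: mult_right_mono power_mono)
  qed
qed (use u in \<open>auto simp: A_BV_def\<close>)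

text \<open>The 1 stands for the distance to the step of height \<open>m\<close>. The second term is
  the cost of replacing \<open>m\<close> by \<open>H_opt\<close>: the height error is at most
  \<open>R2\<^sup>2 / A_fun R2 a\<close> times that distance and acts on a length of at most
  \<open>R2 - R1\<close>.\<close>

definition "stability_const = 1 + R2\<^sup>2 * (R2 - R1) / A_fun R2 a"

text \<open>Collects what the two regimes share. The witnesses are \<open>D_pos u\<close> and the
  moment \<open>E\<close> of the falls about \<open>R2\<close>; the regimes differ in how the gap
  integral controls the deviation from \<open>a\<close>.\<close>

lemma stability_estimates:
  assumes u: "u \<in> A_BV R1 R2"
  obtains \<mu> :: "real measure" and E :: real
  where "finite_measure \<mu>" "sets \<mu> = sets borel" "0 \<le> E"
    "L1_norm (\<lambda>r. u r - u_opt M1 R1 R2 r)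
      \<le> stability_const * ((LINT x:{R1..R2}|\<mu>. \<bar>x - a\<bar>) + E)"
    "l * R2\<^sup>2 / 3 * E + (LINT x:{R1..R2}|\<mu>. q_fun M1 x - l * A_fun R2 x)
      \<le> deficit M1 M2 R1 R2 u"
    "R1^3 * measure \<mu> {R1..R2} \<le> deficit M1 M2 R1 R2 u + l"
proof -
  interpret shell_density M1 M2 R1 R2 u using u by (rule A_BV_shell_density)
  have R12': "R1 \<le> R2" using R12 by simp
  have iu: "integrable lebesgue u" and out: "AE r in lebesgue. r \<notin> {R1..R2} \<longrightarrow> u r = 0"
    using u by (auto simp: A_BV_def BV_def)
  define \<mu> where "\<mu> = D_pos u"
  obtain \<nu> where D: "has_distr_deriv u \<mu> \<nu>"
    using D_pos_distr_deriv u unfolding \<mu>_def A_BV_def by blast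
  have fin: "finite_measure \<mu>" "finite_measure \<nu>" and sets: "sets \<mu> = sets borel" "sets \<nu> = sets borel"
    using D by (auto simp: has_distr_deriv_def)
  define m where "m = measure \<mu> {R1..R2}"
  note u_eq = distr_deriv_restrict(1)[OF D iu out R12']
  define E where "E = (LINT x:{R1..R2}|\<nu>. R2 - x)"
  define Dev where "Dev = (LINT x:{R1..R2}|\<mu>. \<bar>x - a\<bar>)"
  have E0: "0 \<le> E" unfolding E_def set_lebesgue_integral_def
    by (rule integral_nonneg_AE) (auto simp: indicator_def)
  \<comment> \<open>\<open>E\<close> has two guises: as a moment of \<open>\<nu>\<close> it is
    bounded by the deficit, as the integral of \<open>measure \<nu> {R1..s}\<close> it bounds the
    contribution of the falls to the L1 distance.\<close>
  have tail: "set_integrable lebesgue {R1..R2} (\<lambda>s. measure \<nu> {R1..s})"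
    "(LINT s:{R1..R2}|lebesgue. measure \<nu> {R1..s}) = E"
  proof -
    note G = integral_measure_atLeastAtMost[OF fin(2) sets(2), of "\<lambda>_. 1" R1 R2 1, simplified]
    show "set_integrable lebesgue {R1..R2} (\<lambda>s. measure \<nu> {R1..s})" using G(2) .
    have "(LINT s:{R1..R2}|lebesgue. measure \<nu> {R1..s})
        = (LINT x:{R1..R2}|\<nu>. LINT s:{x..R2}|lborel. 1)" using G(3) by simp
    also have "\<dots> = E" unfolding E_def
      by (rule set_lebesgue_integral_cong) (use sets in \<open>auto simp: set_lebesgue_integral_def\<close>)
    finally show "(LINT s:{R1..R2}|lebesgue. measure \<nu> {R1..s}) = E" .
  qed
  have moment: "set_integrable lebesgue {R1..R2} (\<lambda>s. s\<^sup>2 * measure \<rho> {R1..s})"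
    "(LINT s:{R1..R2}|lebesgue. s\<^sup>2 * measure \<rho> {R1..s}) = (LINT x:{R1..R2}|\<rho>. A_fun R2 x)"
    if \<rho>: "finite_measure \<rho>" "sets \<rho> = sets borel" for \<rho> :: "real measure"
  proof -
    have "\<bar>s\<^sup>2\<bar> \<le> R2\<^sup>2" if "s \<in> {R1..R2}" for s
      using that R1_pos by (auto intro!: power_mono)
    note G = integral_measure_atLeastAtMost[OF \<rho>, of "\<lambda>s. s\<^sup>2" R1 R2, OF _ this, simplified]
    show "set_integrable lebesgue {R1..R2} (\<lambda>s. s\<^sup>2 * measure \<rho> {R1..s})" using G(2) .
    have "(LINT s:{R1..R2}|lebesgue. s\<^sup>2 * measure \<rho> {R1..s})
        = (LINT x:{R1..R2}|\<rho>. LINT s:{x..R2}|lborel. s\<^sup>2)" using G(3) by simp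
    also have "\<dots> = (LINT x:{R1..R2}|\<rho>. A_fun R2 x)"
      by (rule set_lebesgue_integral_cong) (use \<rho> integral_square_interval in auto)
    finally show "(LINT s:{R1..R2}|lebesgue. s\<^sup>2 * measure \<rho> {R1..s}) = (LINT x:{R1..R2}|\<rho>. A_fun R2 x)" .
  qed
  have mass_split: "(LINT x:{R1..R2}|\<mu>. A_fun R2 x) - (LINT x:{R1..R2}|\<nu>. A_fun R2 x) = 1"
  proof -
    have "1 = (LINT s:{R1..R2}|lebesgue. s\<^sup>2 * u s)" using unit_mass by simp
    also have "\<dots> = (LINT s:{R1..R2}|lebesgue. s\<^sup>2 * measure \<mu> {R1..s} - s\<^sup>2 * measure \<nu> {R1..s})"
      unfolding set_lebesgue_integral_def
    proof (rule integral_cong_AE)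
      show "AE s in lebesgue. indicat_real {R1..R2} s *\<^sub>R (s\<^sup>2 * u s)
          = indicat_real {R1..R2} s *\<^sub>R (s\<^sup>2 * measure \<mu> {R1..s} - s\<^sup>2 * measure \<nu> {R1..s})"
        using u_eq by eventually_elim (auto simp: indicator_def right_diff_distrib)
      show "(\<lambda>s. indicat_real {R1..R2} s *\<^sub>R (s\<^sup>2 * u s)) \<in> borel_measurable lebesgue"
        using integrable_mass unfolding set_integrable_def by (rule borel_measurable_integrable)
      show "(\<lambda>s. indicat_real {R1..R2} s *\<^sub>R (s\<^sup>2 * measure \<mu> {R1..s} - s\<^sup>2 * measure \<nu> {R1..s}))
          \<in> borel_measurable lebesgue"
        using set_integral_diff(1)[OF moment(1)[OF fin(1) sets(1)] moment(1)[OF fin(2) sets(2)]]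
        unfolding set_integrable_def by (rule borel_measurable_integrable)
    qed
    also have "\<dots> = (LINT x:{R1..R2}|\<mu>. A_fun R2 x) - (LINT x:{R1..R2}|\<nu>. A_fun R2 x)"
      using set_integral_diff(2)[OF moment(1)[OF fin(1) sets(1)] moment(1)[OF fin(2) sets(2)]]
        moment(2)[OF fin(1) sets(1)] moment(2)[OF fin(2) sets(2)] by simp
    finally show ?thesis by simp
  qed

  have iW: "set_integrable \<mu> {R1..R2} W"
    unfolding set_integrable_def
  proof (rule integrable_bounded_borel[OF fin(1) sets(1)])
    show "(\<lambda>x. indicat_real {R1..R2} x *\<^sub>R W x) \<in> borel_measurable borel"
      using W_measurable by simp
    have "\<bar>W x\<bar> \<le> \<bar>R2^3 / sqrt Fmin\<bar>" if "x \<in> {R1..R2}" for x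
    proof -
      have "0 < W x" "W x \<le> R2^3 / sqrt Fmin" using W_bounds[of x] that by auto
      then show ?thesis by linarith
    qed
    then show "\<bar>indicat_real {R1..R2} x *\<^sub>R W x\<bar> \<le> \<bar>R2^3 / sqrt Fmin\<bar>" for x
      by (cases "x \<in> {R1..R2}") (simp_all del: abs_divide)
  qed
  have iq: "set_integrable \<mu> {R1..R2} (q_fun M1)"
    using M1_R1 R1_pos unfolding q_fun_def
    by (intro set_integrable_continuous[OF fin(1) sets(1)] continuous_intros) auto
  have iA: "set_integrable \<rho> {R1..R2} (\<lambda>x. c * A_fun R2 x)"
    if "finite_measure \<rho>" "sets \<rho> = sets borel" for \<rho> c
    by (intro set_integrable_continuous[OF that] continuous_intros A_fun_continuous_on)
  have J: "(LINT x:{R1..R2}|\<mu>. W x) = deficit M1 M2 R1 R2 u + l"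
    by (simp add: deficit_def J_fun_def \<mu>_def)
  have deficit_ge: "l * R2\<^sup>2 / 3 * E + (LINT x:{R1..R2}|\<mu>. q_fun M1 x - l * A_fun R2 x)
      \<le> deficit M1 M2 R1 R2 u"
  proof -
    have "(LINT x:{R1..R2}|\<mu>. q_fun M1 x) \<le> (LINT x:{R1..R2}|\<mu>. W x)"
      by (rule set_integral_mono[OF iq iW]) (use W_ge in auto)
    moreover have "(LINT x:{R1..R2}|\<mu>. q_fun M1 x - l * A_fun R2 x)
        = (LINT x:{R1..R2}|\<mu>. q_fun M1 x) - l * (LINT x:{R1..R2}|\<mu>. A_fun R2 x)"
      using set_integral_diff(2)[OF iq iA[OF fin(1) sets(1)]] by simp
    moreover have "R2\<^sup>2 / 3 * E \<le> (LINT x:{R1..R2}|\<nu>. A_fun R2 x)"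
    proof -
      have "R2\<^sup>2 / 3 * E = (LINT x:{R1..R2}|\<nu>. R2\<^sup>2 / 3 * (R2 - x))" by (simp add: E_def)
      also have "\<dots> \<le> (LINT x:{R1..R2}|\<nu>. A_fun R2 x)"
      proof (rule set_integral_mono)
        show "set_integrable \<nu> {R1..R2} (\<lambda>x. R2\<^sup>2 / 3 * (R2 - x))"
          by (intro set_integrable_continuous fin sets continuous_intros)
        show "set_integrable \<nu> {R1..R2} (A_fun R2)"
          by (intro set_integrable_continuous fin sets A_fun_continuous_on)
      qed (use A_fun_ge_linear R1_pos in auto)
      finally show ?thesis .
    qed
    then have "l * (R2\<^sup>2 / 3 * E) \<le> l * (LINT x:{R1..R2}|\<nu>. A_fun R2 x)"
      using l_pos by (intro mult_left_mono) auto
    \<comment> \<open>The mass constraint times \<open>l\<close>: its constant term is the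
      \<open>l\<close> that the deficit subtracts, and the remainder pays for the falls.\<close>
    moreover have "l * (LINT x:{R1..R2}|\<mu>. A_fun R2 x) = l + l * (LINT x:{R1..R2}|\<nu>. A_fun R2 x)"
      using mass_split by (simp add: algebra_simps)
    ultimately show ?thesis using J by simp
  qed
  have mass_bound: "R1^3 * m \<le> deficit M1 M2 R1 R2 u + l"
  proof -
    have "R1^3 * m = (LINT x:{R1..R2}|\<mu>. R1^3)"
      using sets fin sets_eq_imp_space_eq[OF sets(1)] by (simp add: m_def set_lebesgue_integral_def mult.commute)
    also have "\<dots> \<le> (LINT x:{R1..R2}|\<mu>. W x)"
    proof (rule set_integral_mono[OF set_integrable_continuous[OF fin(1) sets(1)] iW])
      fix x assume x: "x \<in> {R1..R2}"
      then have "R1^3 \<le> x^3" using R1_pos by (intro power_mono) auto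
      also have "x^3 \<le> W x" using x q_fun_ge[OF M1, of x] W_ge[of x] M1_R1 by simp
      finally show "R1^3 \<le> W x" .
    qed simp
    finally show ?thesis using J by simp
  qed

  obtain K where K: "set_integrable lebesgue {R1..R2} K" "(LINT s:{R1..R2}|lebesgue. K s) = Dev"
    "\<And>s. s \<in> {R1..R2} \<Longrightarrow> \<bar>measure \<mu> {R1..s} - m * indicator {a<..} s\<bar> \<le> K s"
    using integral_cdf_deviation[OF fin(1) sets(1) a_bounds(1)] a_bounds(2) unfolding Dev_def m_def
    by (metis less_imp_le)
  define w where "w s = u s - m * indicator {a<..} s" for s
  have iind: "set_integrable lebesgue {R1..R2} (indicat_real {a<..})"
    by (rule set_integrable_bound[where f = "\<lambda>_. 1 :: real"])
      (auto simp: set_borel_measurable_def indicator_def intro!: absolutely_integrable_continuous_real measurable_completion)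
  have iw: "set_integrable lebesgue {R1..R2} w" unfolding w_def
  proof (rule set_integral_diff(1))
    show "set_integrable lebesgue {R1..R2} u"
      using iu unfolding set_integrable_def by (intro integrable_mult_indicator) auto
  qed (use iind in auto)
  define Lw where "Lw = (LINT s:{R1..R2}|lebesgue. \<bar>w s\<bar>)"
  have Lw_le: "Lw \<le> Dev + E"
  proof -
    have "Lw \<le> (LINT s:{R1..R2}|lebesgue. K s + measure \<nu> {R1..s})" unfolding Lw_def
    proof (rule set_integral_mono_AE)
      show "AE s\<in>{R1..R2} in lebesgue. \<bar>w s\<bar> \<le> K s + measure \<nu> {R1..s}"
        using u_eq
      proof eventually_elim
        case (elim s)
        show ?case
        proof
          assume s: "s \<in> {R1..R2}"
          have "w s = (measure \<mu> {R1..s} - m * indicator {a<..} s) - measure \<nu> {R1..s}"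
            using elim s by (simp add: w_def)
          then show "\<bar>w s\<bar> \<le> K s + measure \<nu> {R1..s}"
            using K(3)[OF s] measure_nonneg[of \<nu> "{R1..s}"] by linarith
        qed
      qed
    qed (intro set_integrable_abs iw set_integral_add(1) K(1) tail(1))+
    also have "\<dots> = Dev + E"
      using set_integral_add(2)[OF K(1) tail(1)] K(2) tail(2) by simp
    finally show ?thesis .
  qed
  have A: "0 < A_fun R2 a" using A_fun_pos a_bounds R1_pos by simp
  \<comment> \<open>Against s^2, \<open>u\<close> integrates to 1 and the step of height
    \<open>m\<close> to m A(a). The difference is at most \<open>R2\<^sup>2 * Lw\<close>, and
    \<open>H_opt\<close> is 1/A(a).\<close>
  have m_bound: "\<bar>m - H_opt M1 R1 R2\<bar> \<le> R2\<^sup>2 * Lw / A_fun R2 a"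
  proof -
    have isq: "set_integrable lebesgue {R1..R2} (\<lambda>s. s\<^sup>2 * indicator {a<..} s)"
      by (rule set_integrable_bound[where f = "\<lambda>s. s\<^sup>2"])
        (auto simp: set_borel_measurable_def indicator_def
          intro!: absolutely_integrable_continuous_real continuous_intros measurable_completion)
    have "(LINT s:{R1..R2}|lebesgue. s\<^sup>2 * indicator {a<..} s) = (LINT s:{a..R2}|lebesgue. s\<^sup>2)"
      unfolding set_lebesgue_integral_def
    proof (rule integral_cong_AE)
      have "AE s in lebesgue. s \<noteq> a" by (rule AE_completion) (rule AE_lborel_singleton)
      then show "AE s in lebesgue. indicat_real {R1..R2} s *\<^sub>R (s\<^sup>2 * indicator {a<..} s)
          = indicat_real {a..R2} s *\<^sub>R s\<^sup>2"
        by eventually_elim (use a_bounds in \<open>auto simp: indicator_def\<close>)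
      show "(\<lambda>s. indicat_real {R1..R2} s *\<^sub>R (s\<^sup>2 * indicator {a<..} s)) \<in> borel_measurable lebesgue"
        using isq unfolding set_integrable_def by (rule borel_measurable_integrable)
      show "(\<lambda>s. indicat_real {a..R2} s *\<^sub>R s\<^sup>2) \<in> borel_measurable lebesgue"
        by (intro measurable_completion) simp
    qed
    also have "\<dots> = A_fun R2 a"
      by (subst FTC_lebesgue(2)[of _ _ "\<lambda>r. r^3 / 3"])
        (use a_bounds in \<open>auto intro!: derivative_eq_intros continuous_intros simp: A_fun_def diff_divide_distrib\<close>)
    finally have Aa: "(LINT s:{R1..R2}|lebesgue. s\<^sup>2 * indicator {a<..} s) = A_fun R2 a" .
    have "(LINT s:{R1..R2}|lebesgue. s\<^sup>2 * w s)
        = (LINT s:{R1..R2}|lebesgue. s\<^sup>2 * u s - m * (s\<^sup>2 * indicator {a<..} s))"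
      by (simp add: w_def algebra_simps)
    also have "\<dots> = 1 - m * A_fun R2 a"
      by (subst set_integral_diff(2)[OF integrable_mass]) (use isq Aa unit_mass in auto)
    finally have eq: "(LINT s:{R1..R2}|lebesgue. s\<^sup>2 * w s) = 1 - m * A_fun R2 a" .
    have isw: "set_integrable lebesgue {R1..R2} (\<lambda>s. s\<^sup>2 * w s)"
      unfolding w_def right_diff_distrib
      using set_integral_diff(1)[OF integrable_mass set_integrable_mult_right[OF isq, of m]]
      by (simp add: algebra_simps)
    have "\<bar>1 - m * A_fun R2 a\<bar> \<le> (LINT s:{R1..R2}|lebesgue. \<bar>s\<^sup>2 * w s\<bar>)"
      unfolding eq[symmetric] using set_integral_norm_bound[OF isw] by simp
    also have "\<dots> \<le> (LINT s:{R1..R2}|lebesgue. R2\<^sup>2 * \<bar>w s\<bar>)"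
    proof (rule set_integral_mono)
      show "\<bar>s\<^sup>2 * w s\<bar> \<le> R2\<^sup>2 * \<bar>w s\<bar>" if "s \<in> {R1..R2}" for s
        using that R1_pos by (auto simp: abs_mult intro!: mult_right_mono power_mono)
    qed (intro set_integrable_abs isw set_integrable_mult_right iw)+
    also have "\<dots> = R2\<^sup>2 * Lw" by (simp add: Lw_def)
    finally have "\<bar>1 - m * A_fun R2 a\<bar> \<le> R2\<^sup>2 * Lw" .
    moreover have "m - H_opt M1 R1 R2 = - (1 - m * A_fun R2 a) / A_fun R2 a"
      using A by (simp add: H_opt_def field_simps)
    ultimately show ?thesis using A by (simp add: abs_divide divide_right_mono abs_minus_commute)
  qed
  have ic: "set_integrable lebesgue {R1..R2} (\<lambda>s. \<bar>m - H_opt M1 R1 R2\<bar>)"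
    by (rule absolutely_integrable_continuous_real) simp
  have "L1_norm (\<lambda>r. u r - u_opt M1 R1 R2 r)
      \<le> (LINT s:{R1..R2}|lebesgue. \<bar>w s\<bar> + \<bar>m - H_opt M1 R1 R2\<bar>)"
    unfolding L1_norm_def set_lebesgue_integral_def
  proof (rule integral_mono_AE')
    show "integrable lebesgue (\<lambda>s. indicat_real {R1..R2} s *\<^sub>R (\<bar>w s\<bar> + \<bar>m - H_opt M1 R1 R2\<bar>))"
      using set_integral_add(1)[OF set_integrable_abs[OF iw] ic] by (simp add: set_integrable_def)
    \<comment> \<open>\<open>u_opt\<close> lives on the open interval \<open>(a, R2)\<close>,
      whereas \<open>w\<close> uses the ray beyond \<open>a\<close>; within \<open>[R1, R2]\<close>
      the indicators differ only at \<open>R2\<close>.\<close>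
    have "AE s in lebesgue. s \<noteq> R2" by (rule AE_completion) (rule AE_lborel_singleton)
    then show "AE s in lebesgue. \<bar>u s - u_opt M1 R1 R2 s\<bar>
        \<le> indicat_real {R1..R2} s *\<^sub>R (\<bar>w s\<bar> + \<bar>m - H_opt M1 R1 R2\<bar>)"
      using out
    proof eventually_elim
      case (elim s)
      show ?case
      proof (cases "s \<in> {R1..R2}")
        case True
        then have "u s - u_opt M1 R1 R2 s = w s + (m - H_opt M1 R1 R2) * indicator {a<..} s"
          using elim(1) by (auto simp: u_opt_def w_def indicator_def)
        moreover have "\<bar>(m - H_opt M1 R1 R2) * indicator {a<..} s\<bar> \<le> \<bar>m - H_opt M1 R1 R2\<bar>"
          by (auto simp: indicator_def)
        ultimately show ?thesis using True by simp
      next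
        case False
        then show ?thesis using elim(2) a_bounds by (auto simp: u_opt_def)
      qed
    qed
  qed auto
  also have "\<dots> = Lw + \<bar>m - H_opt M1 R1 R2\<bar> * (R2 - R1)"
  proof -
    have "(LINT s:{R1..R2}|lebesgue. \<bar>m - H_opt M1 R1 R2\<bar>) = \<bar>m - H_opt M1 R1 R2\<bar> * (R2 - R1)"
      using R12 by (simp add: set_lebesgue_integral_def)
    then show ?thesis
      using set_integral_add(2)[OF set_integrable_abs[OF iw] ic] by (simp add: Lw_def)
  qed
  also have "\<dots> \<le> Lw + R2\<^sup>2 * Lw / A_fun R2 a * (R2 - R1)"
    using m_bound R12 by (intro add_left_mono mult_right_mono) auto
  also have "\<dots> = stability_const * Lw"
    by (simp add: stability_const_def algebra_simps)
  also have "\<dots> \<le> stability_const * (Dev + E)"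
    using Lw_le R12 A by (intro mult_left_mono) (auto simp: stability_const_def)
  finally show ?thesis
    using that fin(1) sets(1) E0 deficit_ge mass_bound unfolding Dev_def m_def by blast
qed

end

section \<open>The linear and the square-root regime\<close>

context shell begin

lemma stability_const_nonneg: "0 \<le> stability_const"
proof -
  have "0 < A_fun R2 a" using A_fun_pos a_bounds R1_pos by simp
  then show ?thesis using R12 by (simp add: stability_const_def)
qed

lemma gap_integrable:
  assumes "finite_measure \<mu>" "sets \<mu> = sets borel"
  shows "set_integrable \<mu> {R1..R2} (\<lambda>x. q_fun M1 x - l * A_fun R2 x)"
proof (rule set_integrable_continuous[OF assms])
  show "continuous_on {R1..R2} (\<lambda>x. q_fun M1 x - l * A_fun R2 x)"
    unfolding q_fun_def using M1_R1 R1_pos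
    by (intro continuous_intros A_fun_continuous_on) auto
qed

text \<open>The linear gap dominates the deviation from \<open>a\<close> itself, so both error terms
  are at most a constant times the deficit.\<close>

lemma stability_boundary:
  assumes "x0 < R1"
  obtains C where "\<And>u. u \<in> A_BV R1 R2 \<Longrightarrow>
    L1_norm (\<lambda>r. u r - u_opt M1 R1 R2 r) \<le> C * deficit M1 M2 R1 R2 u"
proof -
  obtain c where c: "0 < c"
    "\<And>r. R1 \<le> r \<Longrightarrow> r \<le> R2 \<Longrightarrow> c * \<bar>r - a\<bar> \<le> q_fun M1 r - l * A_fun R2 r"
    using q_minus_lA_boundary[OF assms] by blast
  define b where "b = l * R2\<^sup>2 / 3"
  have b: "0 < b" using l_pos R2_pos by (simp add: b_def)
  have "L1_norm (\<lambda>r. u r - u_opt M1 R1 R2 r) \<le> stability_const * (1 / c + 1 / b) * deficit M1 M2 R1 R2 u"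
    if u: "u \<in> A_BV R1 R2" for u
  proof -
    define \<delta> where "\<delta> = deficit M1 M2 R1 R2 u"
    obtain \<mu> E where \<mu>: "finite_measure \<mu>" "sets \<mu> = sets borel" and E: "0 \<le> E"
      and norm: "L1_norm (\<lambda>r. u r - u_opt M1 R1 R2 r)
        \<le> stability_const * ((LINT x:{R1..R2}|\<mu>. \<bar>x - a\<bar>) + E)"
      and def: "b * E + (LINT x:{R1..R2}|\<mu>. q_fun M1 x - l * A_fun R2 x) \<le> \<delta>"
      using stability_estimates[OF u] unfolding b_def \<delta>_def by blast
    define Dev where "Dev = (LINT x:{R1..R2}|\<mu>. \<bar>x - a\<bar>)"
    have Dev0: "0 \<le> Dev" unfolding Dev_def set_lebesgue_integral_def by (rule integral_nonneg_AE) simp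
    have "c * Dev = (LINT x:{R1..R2}|\<mu>. c * \<bar>x - a\<bar>)" by (simp add: Dev_def)
    also have "\<dots> \<le> (LINT x:{R1..R2}|\<mu>. q_fun M1 x - l * A_fun R2 x)"
    proof (rule set_integral_mono[OF _ gap_integrable[OF \<mu>]])
      show "set_integrable \<mu> {R1..R2} (\<lambda>x. c * \<bar>x - a\<bar>)"
        by (intro set_integrable_continuous[OF \<mu>] continuous_intros)
    qed (use c(2) in auto)
    finally have sum: "b * E + c * Dev \<le> \<delta>" using def by simp
    have "Dev \<le> \<delta> / c" "E \<le> \<delta> / b"
      using sum b c E Dev0 by (simp_all add: field_simps add_increasing add_increasing2 order_trans[rotated, OF sum])
    then have "stability_const * (Dev + E) \<le> stability_const * (\<delta> / c + \<delta> / b)"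
      using stability_const_nonneg by (intro mult_left_mono add_mono)
    then show ?thesis using norm by (simp add: Dev_def \<delta>_def algebra_simps)
  qed
  then show ?thesis using that by blast
qed

text \<open>The quadratic gap controls only the second moment \<open>V\<close>, and passing to the
  first moment costs a square root. The bound 1 on the deficit enters in limiting the total rise and
  in absorbing the linear term of the falls.\<close>

lemma stability_interior:
  assumes "R1 \<le> x0"
  obtains C where "\<And>u. u \<in> A_BV R1 R2 \<Longrightarrow> deficit M1 M2 R1 R2 u \<le> 1 \<Longrightarrow>
    L1_norm (\<lambda>r. u r - u_opt M1 R1 R2 r) \<le> C * sqrt (deficit M1 M2 R1 R2 u)"
proof -
  obtain c where c: "0 < c"
    "\<And>r. R1 \<le> r \<Longrightarrow> r \<le> R2 \<Longrightarrow> c * (r - a)\<^sup>2 \<le> q_fun M1 r - l * A_fun R2 r"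
    using q_minus_lA_interior[OF assms] by blast
  define b where "b = l * R2\<^sup>2 / 3"
  have b: "0 < b" using l_pos R2_pos by (simp add: b_def)
  \<comment> \<open>A bound for the total rise: the cost is at least \<open>R1^3\<close> times the
    rise and at most \<open>1 + l\<close>.\<close>
  define m where "m = (1 + l) / R1^3"
  have m: "0 < m" using l_pos R1_pos by (simp add: m_def)
  have "L1_norm (\<lambda>r. u r - u_opt M1 R1 R2 r)
      \<le> stability_const * ((m + 1 / c) / 2 + 1 / b) * sqrt (deficit M1 M2 R1 R2 u)"
    if u: "u \<in> A_BV R1 R2" and le1: "deficit M1 M2 R1 R2 u \<le> 1" for u
  proof -
    define \<delta> where "\<delta> = deficit M1 M2 R1 R2 u"
    obtain \<mu> E where \<mu>: "finite_measure \<mu>" "sets \<mu> = sets borel" and E: "0 \<le> E"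
      and norm: "L1_norm (\<lambda>r. u r - u_opt M1 R1 R2 r)
        \<le> stability_const * ((LINT x:{R1..R2}|\<mu>. \<bar>x - a\<bar>) + E)"
      and def: "b * E + (LINT x:{R1..R2}|\<mu>. q_fun M1 x - l * A_fun R2 x) \<le> \<delta>"
      and mass: "R1^3 * measure \<mu> {R1..R2} \<le> \<delta> + l"
      using stability_estimates[OF u] unfolding b_def \<delta>_def by blast
    have "R1^3 * measure \<mu> {R1..R2} \<le> 1 + l" using mass le1 \<delta>_def by simp
    then have mass': "measure \<mu> {R1..R2} \<le> m" using R1_pos by (simp add: m_def field_simps)
    define Dev where "Dev = (LINT x:{R1..R2}|\<mu>. \<bar>x - a\<bar>)"
    define V where "V = (LINT x:{R1..R2}|\<mu>. (x - a)\<^sup>2)"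
    have V0: "0 \<le> V" unfolding V_def set_lebesgue_integral_def by (rule integral_nonneg_AE) simp
    have "c * V = (LINT x:{R1..R2}|\<mu>. c * (x - a)\<^sup>2)" by (simp add: V_def)
    also have "\<dots> \<le> (LINT x:{R1..R2}|\<mu>. q_fun M1 x - l * A_fun R2 x)"
    proof (rule set_integral_mono[OF _ gap_integrable[OF \<mu>]])
      show "set_integrable \<mu> {R1..R2} (\<lambda>x. c * (x - a)\<^sup>2)"
        by (intro set_integrable_continuous[OF \<mu>] continuous_intros)
    qed (use c(2) in auto)
    finally have sum: "b * E + c * V \<le> \<delta>" using def by simp
    have bE: "0 \<le> b * E" and cV: "0 \<le> c * V" using b c E V0 by auto
    have \<delta>0: "0 \<le> \<delta>" using sum bE cV by linarith
    have V: "V \<le> \<delta> / c" using sum bE c(1) by (simp add: pos_le_divide_eq mult.commute)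
    have E': "E \<le> \<delta> / b" using sum cV b by (simp add: pos_le_divide_eq mult.commute)
    \<comment> \<open>Cauchy-Schwarz in the form of AM-GM with a free parameter, to be taken as \<open>sqrt \<delta>\<close>.\<close>
    have amgm: "Dev \<le> (t * m + V / t) / 2" if t: "0 < t" for t
    proof -
      have "Dev \<le> (LINT x:{R1..R2}|\<mu>. t / 2 + 1 / (2 * t) * (x - a)\<^sup>2)"
        unfolding Dev_def
      proof (rule set_integral_mono)
        fix x
        have "0 \<le> (\<bar>x - a\<bar> - t)\<^sup>2" by simp
        then have "2 * t * \<bar>x - a\<bar> \<le> t * t + (x - a)\<^sup>2" by (simp add: power2_eq_square algebra_simps)
        then show "\<bar>x - a\<bar> \<le> t / 2 + 1 / (2 * t) * (x - a)\<^sup>2" using t by (simp add: field_simps)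
      qed (intro set_integrable_continuous[OF \<mu>] continuous_intros)+
      also have "\<dots> = t / 2 * measure \<mu> {R1..R2} + 1 / (2 * t) * V"
      proof -
        have i: "set_integrable \<mu> {R1..R2} (\<lambda>x. t / 2)" "set_integrable \<mu> {R1..R2} (\<lambda>x. 1 / (2 * t) * (x - a)\<^sup>2)"
          by (intro set_integrable_continuous[OF \<mu>] continuous_intros)+
        have "(LINT x:{R1..R2}|\<mu>. t / 2) = t / 2 * measure \<mu> {R1..R2}"
          using \<mu> sets_eq_imp_space_eq[OF \<mu>(2)] by (simp add: set_lebesgue_integral_def)
        moreover have "(LINT x:{R1..R2}|\<mu>. 1 / (2 * t) * (x - a)\<^sup>2) = 1 / (2 * t) * V"
          unfolding V_def by (rule set_integral_mult_right)
        ultimately show ?thesis using set_integral_add(2)[OF i] by simp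
      qed
      also have "\<dots> \<le> t / 2 * m + 1 / (2 * t) * V" using t mass' by (intro add_right_mono mult_left_mono) auto
      finally show ?thesis by (simp add: field_simps)
    qed
    have Dev: "Dev \<le> (m + 1 / c) / 2 * sqrt \<delta>"
    proof (cases "\<delta> = 0")
      case True
      then have "V = 0" using V V0 by simp
      \<comment> \<open>Here \<open>sqrt \<delta>\<close> is not an admissible parameter. As
        \<open>V\<close> vanishes, \<open>t = 2 * e / m\<close> turns the bound into an arbitrary
        \<open>e > 0\<close>.\<close>
      have "Dev \<le> 0"
      proof (rule field_le_epsilon)
        fix e :: real assume "0 < e"
        then show "Dev \<le> 0 + e" using amgm[of "2 * e / m"] m \<open>V = 0\<close> by simp
      qed
      then show ?thesis using True by simp
    next
      case False
      then have s: "0 < sqrt \<delta>" using \<delta>0 by simp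
      have "V / sqrt \<delta> \<le> \<delta> / c / sqrt \<delta>" using V s by (intro divide_right_mono) auto
      also have "\<dots> = sqrt \<delta> / c" using \<delta>0 by (simp add: real_div_sqrt flip: divide_divide_eq_left' )
      finally have "Dev \<le> (sqrt \<delta> * m + sqrt \<delta> / c) / 2" using amgm[OF s] by simp
      then show ?thesis by (simp add: algebra_simps)
    qed
    have "\<delta> \<le> sqrt \<delta>"
      using \<delta>0 le1 by (intro real_le_rsqrt) (simp add: \<delta>_def power2_eq_square mult_left_le)
    then have "E \<le> 1 / b * sqrt \<delta>" using E' b by (simp add: order_trans[OF _ divide_right_mono])
    with Dev have "stability_const * (Dev + E) \<le> stability_const * ((m + 1 / c) / 2 * sqrt \<delta> + 1 / b * sqrt \<delta>)"
      using stability_const_nonneg by (intro mult_left_mono add_mono)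
    then show ?thesis using norm by (simp add: Dev_def \<delta>_def distrib_right mult.assoc)
  qed
  then show ?thesis using that by blast
qed

end

theorem corollary5p1:
  fixes M1 M2 R2 :: real
  assumes "0 < M1" and "M1 < M2" and "2 * M2 < R2"
  shows
    "(\<forall>R1 \<in> {2 * M2<..<R2}. Lambda M1 M2 R2 R1 = Psi M1 R2 (max R1 (x_crit M1 R2)))
     \<and> (2 * M2 < x_crit M1 R2 \<longrightarrow>
          (\<forall>R1. 2 * M2 < R1 \<and> R1 \<le> x_crit M1 R2 \<longrightarrow>
             Lambda M1 M2 R2 R1 = Psi M1 R2 (x_crit M1 R2) \<and> a_opt M1 R1 R2 = x_crit M1 R2)
        \<and> (\<forall>R1. x_crit M1 R2 \<le> R1 \<and> R1 < R2 \<longrightarrow>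
             Lambda M1 M2 R2 R1 = Psi M1 R2 R1 \<and> a_opt M1 R1 R2 = R1)
        \<and> Ck_at 1 (Lambda M1 M2 R2) (x_crit M1 R2)
        \<and> \<not> Ck_at 2 (Lambda M1 M2 R2) (x_crit M1 R2))
     \<and> (\<forall>R1 \<in> {2 * M2<..<R2}. \<exists>C. \<forall>u \<in> A_BV R1 R2. deficit M1 M2 R1 R2 u \<le> 1 \<longrightarrow>
          (R1 \<le> x_crit M1 R2 \<longrightarrow>
             L1_norm (\<lambda>r. u r - u_opt M1 R1 R2 r) \<le> C * sqrt (deficit M1 M2 R1 R2 u))
        \<and> (x_crit M1 R2 < R1 \<longrightarrow>
             L1_norm (\<lambda>r. u r - u_opt M1 R1 R2 r) \<le> C * deficit M1 M2 R1 R2 u))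
     \<and> (x_crit M1 R2 \<le> 2 * M2 \<longrightarrow>
          (\<forall>R1 \<in> {2 * M2<..<R2}. x_crit M1 R2 < R1 \<and> a_opt M1 R1 R2 = R1 \<and>
             Lambda M1 M2 R2 R1 = Psi M1 R2 R1))"
proof -
  have eq: "Lambda M1 M2 R2 R1 = Psi M1 R2 (max R1 (x_crit M1 R2))" if "2 * M2 < R1" "R1 < R2" for R1
    using Lambda_eq_Psi assms(1,2) that by blast
  have x_lt: "x_crit M1 R2 < R2" using x_crit(3) assms by simp
  \<comment> \<open>For a given \<open>R1\<close> only one regime applies, so its constant serves as
    \<open>C\<close> and the other implication is vacuous.\<close>
  have stab: "\<exists>C. \<forall>u \<in> A_BV R1 R2. deficit M1 M2 R1 R2 u \<le> 1 \<longrightarrow>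
          (R1 \<le> x_crit M1 R2 \<longrightarrow>
             L1_norm (\<lambda>r. u r - u_opt M1 R1 R2 r) \<le> C * sqrt (deficit M1 M2 R1 R2 u))
        \<and> (x_crit M1 R2 < R1 \<longrightarrow>
             L1_norm (\<lambda>r. u r - u_opt M1 R1 R2 r) \<le> C * deficit M1 M2 R1 R2 u)"
    if "2 * M2 < R1" "R1 < R2" for R1
  proof -
    interpret shell M1 M2 R1 R2 using assms(1,2) that by unfold_locales
    show ?thesis
    proof (cases "R1 \<le> x_crit M1 R2")
      case True
      then show ?thesis using stability_interior by (metis not_le)
    next
      case False
      then show ?thesis using stability_boundary by (metis not_le)
    qed
  qed
  show ?thesis
    using eq stab x_lt Lambda_C1[OF assms] Lambda_not_C2[OF assms]
    by (auto simp: a_opt_def max_def)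
qed

end
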